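(* Let $\mathcal{K}_3$ be the class of all $f\in\mathcal{A}$ with $\operatorname{Re}\left(\frac{1-z^2}{z}f(z)\right)>0$ for all $z\in\mathbb{D}$. For $f\in\mathcal{K}_3$, the following results hold: (1) The sharp $\mathcal{S}^*(\alpha)$-radius of $\mathcal{K}_3$ is the smallest positive real root of the equation $(1+\alpha)r^4-2r(r^2+r+1)+(1-\alpha)=0$, $0\le\alpha<1$. (2) The sharp $\mathcal{S}^*_L$-radius of $\mathcal{K}_3$ is $\frac{\sqrt2-1}{\sqrt2+1}\approx 0.171573$. (3) The sharp $\mathcal{S}_P$-radius of $\mathcal{K}_3$ is the smallest positive real root of $4r^3+4r^2+4r-1-3r^4=0$, i.e. $\approx 0.2021347$. (4) The sharp $\mathcal{S}^*_e$-radius of $\mathcal{K}_3$ is the smallest positive real root of $(2r^3+2r^2+2r-1-r^4)e+1-r^4=0$, i.e. $\approx 0.244259$. (5) The sharp $\mathcal{S}^*_c$-radius of $\mathcal{K}_3$ is the smallest positive real root of $3r^3+3r^2+3r-1-2r^4=0$, i.e. $\approx 0.254726$. (6) The sharp $\mathcal{S}^*_{\mathrm{moon}}$-radius of $\mathcal{K}_3$ is the smallest positive real root of $2r^3+2r^2+2r-\sqrt2\,r^4=2-\sqrt2$, i.e. $\approx 0.229877$. (7) The sharp $\mathcal{S}^*_{\sin}$-radius of $\mathcal{K}_3$ is $\frac{\sin 1}{2+\sin 1}\approx 0.296139$. (8) The sharp $\mathcal{S}^*_R$-radius of $\mathcal{K}_3$ is the smallest positive real root of $r^4+2r^3+2r^2+2r-3+2\sqrt2(1-r^4)=0$,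 i.e. $\approx 0.0790749$. (9) The $\mathcal{S}^*_{RL}$-radius of $\mathcal{K}_3$ is $\approx 0.125145$.
   Context: $\mathbb{D}=\{z\in\mathbb{C}:|z|<1\}$; $\mathcal{A}$ is the class of analytic functions $f$ on $\mathbb{D}$ with $f(0)=0$, $f'(0)=1$. The quotient $(1-z^2)f(z)/z$ is understood with its removable singularity at $z=0$ filled in (value $1$). Radius: for classes $\mathcal{G},\mathcal{H}$ of analytic functions on $\mathbb{D}$, the $\mathcal{H}$-radius of $\mathcal{G}$ is the maximal $\rho\le 1$ such that for every $f\in\mathcal{G}$ the function $f_r(z)=f(rz)/r$ belongs to $\mathcal{H}$ for all $0<r\le\rho$. Subordination: for $f,F$ analytic on $\mathbb{D}$, $f\prec F$ means $f=F\circ w$ for some analytic $w:\mathbb{D}\to\mathbb{D}$ with $w(0)=0$. For $h$ analytic on $\mathbb{D}$, $\mathcal{S}^*(h)$ is the class of $f\in\mathcal{A}$ with $zf'(z)/f(z)\prec h(z)$. Classes: $\mathcal{S}^*(\alpha)$, $0\le\alpha<1$, is the class of starlike functions of order $\alpha$: $f\in\mathcal{A}$ with $\operatorname{Re}(zf'(z)/f(z))>\alpha$ on $\mathbb{D}$. $\mathcal{S}^*_L=\mathcal{S}^*(\sqrt{1+z})$ (lemniscate starlike functions). $\mathcal{S}_P$ (parabolic starlike functions) is the class of $f\in\mathcal{A}$ with $w=zf'(z)/f(z)$ lying in $\{w:(\operatorname{Im}w)^2<2\operatorname{Re}w-1\}=\{w:\operatorname{Re}w>|w-1|\}$ for all $z\in\mathbb{D}$.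 $\mathcal{S}^*_e=\mathcal{S}^*(e^z)$. $\mathcal{S}^*_c=\mathcal{S}^*(1+\tfrac43z+\tfrac23z^2)$. $\mathcal{S}^*_{\mathrm{moon}}=\mathcal{S}^*(z+\sqrt{1+z^2})$. $\mathcal{S}^*_{\sin}=\mathcal{S}^*(1+\sin z)$. $\mathcal{S}^*_{RL}=\mathcal{S}^*(h_{RL})$ with $h_{RL}(z)=\sqrt2-(\sqrt2-1)\sqrt{\frac{1-z}{1+2(\sqrt2-1)z}}$. $\mathcal{S}^*_R=\mathcal{S}^*(h_R)$ with $h_R(z)=1+\frac{kz+z^2}{k^2-kz}$, $k=\sqrt2+1$. Square roots are principal branches. The symbol $\approx$ denotes a decimal approximation.
   Formalization: In (9) only that 0.125145 is an admissible S*_RL-radius of K_3 is proved, not that it is maximal; maximality fails, since the disc bound on zf'/f is not attained at the non-real points where the disc touches the region, and the true radius is about 0.1269. *)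

theory Defs
  imports "HOL-Analysis.Analysis"
begin

text \<open>
  Functions on the unit disc are total functions \<open>complex \<Rightarrow> complex\<close>; all notions
  below only depend on their values on \<open>ball 0 1\<close>.
\<close>

definition class_A :: "(complex \<Rightarrow> complex) set" where
  "class_A = {f. f holomorphic_on ball 0 1 \<and> f 0 = 0 \<and> deriv f 0 = 1}"

definition K3 :: "(complex \<Rightarrow> complex) set" where
  "K3 = {f \<in> class_A. \<forall>z\<in>ball 0 1.
           Re (if z = 0 then 1 else (1 - z\<^sup>2) / z * f z) > 0}"

text \<open>
  The quotient \<open>z f'(z) / f(z)\<close>, with its removable singularity at \<open>0\<close> filled in.
  At a zero of \<open>f\<close> other than \<open>0\<close> it has a pole, where HOL division returns \<open>0\<close>.
  This never admits spurious functions: the value \<open>0\<close> violates the defining conditions of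
  \<open>starlike_of_order\<close> (for \<open>\<alpha> \<ge> 0\<close>) and of \<open>S_P\<close>, and subordination demands holomorphy.
\<close>

definition log_quot :: "(complex \<Rightarrow> complex) \<Rightarrow> complex \<Rightarrow> complex" where
  "log_quot f z = (if z = 0 then 1 else z * deriv f z / f z)"

definition subordinate :: "(complex \<Rightarrow> complex) \<Rightarrow> (complex \<Rightarrow> complex) \<Rightarrow> bool" where
  "subordinate f F \<longleftrightarrow>
     f holomorphic_on ball 0 1 \<and> F holomorphic_on ball 0 1 \<and>
     (\<exists>w. w holomorphic_on ball 0 1 \<and> w ` ball 0 1 \<subseteq> ball 0 1 \<and> w 0 = 0 \<and>
          (\<forall>z\<in>ball 0 1. f z = F (w z)))"

definition S_star :: "(complex \<Rightarrow> complex) \<Rightarrow> (complex \<Rightarrow> complex) set" where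
  "S_star h = {f \<in> class_A. subordinate (log_quot f) h}"

definition starlike_of_order :: "real \<Rightarrow> (complex \<Rightarrow> complex) set" where
  "starlike_of_order \<alpha> = {f \<in> class_A. \<forall>z\<in>ball 0 1. Re (log_quot f z) > \<alpha>}"

definition S_P :: "(complex \<Rightarrow> complex) set" where
  "S_P = {f \<in> class_A. \<forall>z\<in>ball 0 1.
            (Im (log_quot f z))\<^sup>2 < 2 * Re (log_quot f z) - 1}"

definition S_L :: "(complex \<Rightarrow> complex) set" where
  "S_L = S_star (\<lambda>z. csqrt (1 + z))"

definition S_e :: "(complex \<Rightarrow> complex) set" where
  "S_e = S_star exp"

definition S_c :: "(complex \<Rightarrow> complex) set" where
  "S_c = S_star (\<lambda>z. 1 + 4/3 * z + 2/3 * z\<^sup>2)"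

definition S_moon :: "(complex \<Rightarrow> complex) set" where
  "S_moon = S_star (\<lambda>z. z + csqrt (1 + z\<^sup>2))"

definition S_sin :: "(complex \<Rightarrow> complex) set" where
  "S_sin = S_star (\<lambda>z. 1 + sin z)"

definition h_RL :: "complex \<Rightarrow> complex" where
  "h_RL z = of_real (sqrt 2) -
     of_real (sqrt 2 - 1) * csqrt ((1 - z) / (1 + of_real (2 * (sqrt 2 - 1)) * z))"

definition S_RL :: "(complex \<Rightarrow> complex) set" where
  "S_RL = S_star h_RL"

definition h_R :: "complex \<Rightarrow> complex" where
  "h_R z = (let k = of_real (sqrt 2 + 1) in 1 + (k * z + z\<^sup>2) / (k\<^sup>2 - k * z))"

definition S_R :: "(complex \<Rightarrow> complex) set" where
  "S_R = S_star h_R"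

definition admissible_radius ::
    "(complex \<Rightarrow> complex) set \<Rightarrow> (complex \<Rightarrow> complex) set \<Rightarrow> real \<Rightarrow> bool" where
  "admissible_radius G H \<rho> \<longleftrightarrow>
     \<rho> \<le> 1 \<and> (\<forall>f\<in>G. \<forall>r. 0 < r \<and> r \<le> \<rho> \<longrightarrow>
                (\<lambda>z. f (of_real r * z) / of_real r) \<in> H)"

definition is_sharp_radius ::
    "(complex \<Rightarrow> complex) set \<Rightarrow> (complex \<Rightarrow> complex) set \<Rightarrow> real \<Rightarrow> bool" where
  "is_sharp_radius G H \<rho> \<longleftrightarrow>
     admissible_radius G H \<rho> \<and> (\<forall>\<rho>'. admissible_radius G H \<rho>' \<longrightarrow> \<rho>' \<le> \<rho>)"

definition smallest_pos_root :: "(real \<Rightarrow> real) \<Rightarrow> real \<Rightarrow> bool" where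
  "smallest_pos_root g \<rho> \<longleftrightarrow>
     0 < \<rho> \<and> g \<rho> = 0 \<and> (\<forall>r. 0 < r \<and> g r = 0 \<longrightarrow> \<rho> \<le> r)"

text \<open>\<open>approx n x d\<close>: the number \<open>d\<close> is \<open>x\<close> rounded to \<open>n\<close> decimal places.\<close>

definition approx :: "nat \<Rightarrow> real \<Rightarrow> real \<Rightarrow> bool" where
  "approx n x d \<longleftrightarrow> \<bar>x - d\<bar> \<le> 1 / (2 * 10 ^ n)"

end

theory Submission
  imports Defs "HOL-Complex_Analysis.Complex_Analysis"
begin

text \<open>
  Write \<open>f z = z p(z) / (1 - z\<^sup>2)\<close> with \<open>Re p > 0\<close> and \<open>p 0 = 1\<close>. Then
  \<open>z f'(z) / f(z) = (1 + z\<^sup>2) / (1 - z\<^sup>2) + z p'(z) / p(z)\<close>, where the first summand maps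
  \<open>|z| < r\<close> into a disc with centre \<open>ctr r\<close> on the real axis and the second is bounded by
  \<open>2 r / (1 - r\<^sup>2)\<close> (Schwarz--Pick). So \<open>z f' / f\<close> takes its values in the disc with centre
  \<open>ctr r\<close> and radius \<open>rad r\<close>. Its leftmost point is attained at \<open>i r\<close> by \<open>extremal i\<close>, its rightmost
  point at \<open>r\<close> by the Koebe function \<open>extremal 1\<close>. Each radius is the one at which one of these two points
  reaches the boundary of the target region; it remains to see that the disc lies inside
  the region, and that the region is the biholomorphic image of the unit disc near it. The centres are close
  enough to \<open>1\<close> that the disc can be replaced by a larger one with a convenient centre and the same
  critical boundary point.
\<close>

section \<open>The value region of the logarithmic quotient\<close>

text \<open>Subordination asks for a holomorphic \<open>w\<close> into the unit disc, so it is not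
  enough that the value disc lies in the image of \<open>h\<close>. An inverse branch
  \<open>g\<close> of \<open>h\<close> on that disc, holomorphic with \<open>g 1 = 0\<close> and
  modulus below 1, has to be exhibited; then \<open>w\<close> is \<open>g\<close> applied to the
  quotient. Where the bound on \<open>g\<close> resists direct estimation (\<open>exp\<close>,
  \<open>sin\<close>, \<open>h_R\<close>), it follows by connectedness once the image of the unit
  circle under \<open>h\<close> is known to miss the disc.

  Except for the reverse lemniscate the critical boundary points are real. In the subordination
  classes they are \<open>h (-1)\<close> on the left or \<open>h 1\<close> on the right. All
  left-hand cases share one polynomial, \<open>radius_poly c\<close> with \<open>c\<close> the
  critical value, and the equations of the theorem are constant multiples of it. For the reverse
  lemniscate the disc comes closest to the boundary off the real axis, where the two real extremal
  values say nothing. Hence only admissibility of the decimal value is claimed there.\<close>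

lemma norm_diff_less_norm_add_cnj:
  fixes u v :: complex
  assumes "Re u > 0" "Re v > 0"
  shows "cmod (u - v) < cmod (u + cnj v)"
proof -
  have "Re u * Re v > 0" using assms by simp
  moreover have "(cmod (u + cnj v))\<^sup>2 - (cmod (u - v))\<^sup>2 = 4 * (Re u * Re v)"
    unfolding cmod_power2 by (simp add: power2_eq_square algebra_simps)
  ultimately have "(cmod (u - v))\<^sup>2 < (cmod (u + cnj v))\<^sup>2" by linarith
  then show ?thesis by (rule power2_less_imp_less) simp
qed

text \<open>The Schwarz lemma for the map \<open>(P - p a) / (P + cnj (p a))\<close>, where \<open>P\<close> is \<open>p\<close>
  precomposed with the disc automorphism taking \<open>0\<close> to \<open>a\<close>.\<close>

lemma norm_deriv_le_Re:
  assumes p: "p holomorphic_on ball 0 1"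
    and pos: "\<And>z. cmod z < 1 \<Longrightarrow> Re (p z) > 0"
    and a: "cmod a < 1"
  shows "cmod (deriv p a) * (1 - (cmod a)\<^sup>2) \<le> 2 * Re (p a)"
proof -
  define m where "m = Moebius_function 0 (- a)"
  have m_def': "m z = (z + a) / (1 + cnj a * z)" for z
    by (simp add: m_def Moebius_function_simple)
  have mh: "m holomorphic_on ball 0 1"
    unfolding m_def using a by (intro Moebius_function_holomorphic) auto
  have mb: "cmod (m z) < 1" if "cmod z < 1" for z
    unfolding m_def using a that by (intro Moebius_function_norm_lt_1) auto
  have m0: "m 0 = a" by (simp add: m_def')
  define G where "G = (\<lambda>z. (p (m z) - p a) / (p (m z) + cnj (p a)))"
  have nz: "p (m z) + cnj (p a) \<noteq> 0" if "cmod z < 1" for z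
    using pos[OF mb[OF that]] pos[OF a] by (auto simp: complex_eq_iff)
  have pm: "(\<lambda>z. p (m z)) holomorphic_on ball 0 1"
    using holomorphic_on_compose_gen[OF mh p] mb by (auto simp: o_def image_subset_iff)
  have "G holomorphic_on ball 0 1"
    unfolding G_def using nz by (intro holomorphic_intros pm) auto
  moreover have "G 0 = 0" by (simp add: G_def m0)
  moreover have "cmod (G z) < 1" if "cmod z < 1" for z
    using norm_diff_less_norm_add_cnj[OF pos[OF mb[OF that]] pos[OF a]] nz[OF that]
    by (simp add: G_def norm_divide divide_simps)
  ultimately have le1: "cmod (deriv G 0) \<le> 1"
    using Schwarz_Lemma(2)[of G 0] by auto
  have dm: "(m has_field_derivative (1 - (cmod a)\<^sup>2)) (at 0)"
    unfolding m_def'[abs_def]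
    using complex_norm_square[of a] by (auto intro!: derivative_eq_intros simp: mult.commute)
  have dp: "(p has_field_derivative deriv p (m 0)) (at (m 0))"
    using holomorphic_derivI[OF p] a m0 by auto
  have dpm: "((\<lambda>z. p (m z)) has_field_derivative deriv p a * (1 - (cmod a)\<^sup>2)) (at 0)"
    using DERIV_chain2[OF dp dm] m0 by simp
  define D where "D = deriv p a * (1 - (complex_of_real (cmod a))\<^sup>2)"
  define e where "e = p a + cnj (p a)"
  have e: "e = of_real (2 * Re (p a))" by (simp add: e_def complex_add_cnj)
  have e0: "e \<noteq> 0" using pos[OF a] by (simp add: e)
  have "deriv G 0 = D / e"
    unfolding G_def
    using DERIV_imp_deriv[OF DERIV_divide[OF DERIV_diff[OF dpm DERIV_const] DERIV_add[OF dpm DERIV_const]],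
        of "cnj (p a)" "p a"] e0
    by (simp add: m0 flip: D_def e_def)
  moreover have "cmod D = cmod (deriv p a) * \<bar>1 - (cmod a)\<^sup>2\<bar>"
    using norm_of_real[where 'a=complex, of "1 - (cmod a)\<^sup>2"] by (simp add: D_def norm_mult)
  moreover have "cmod e = 2 * Re (p a)" unfolding e norm_of_real using pos[OF a] by simp
  moreover have "(cmod a)\<^sup>2 < 1" using a by (simp add: abs_square_less_1)
  ultimately have "cmod (deriv G 0) = cmod (deriv p a) * (1 - (cmod a)\<^sup>2) / (2 * Re (p a))"
    by (simp add: norm_divide)
  with le1 show ?thesis using pos[OF a] by (simp add: divide_simps)
qed

lemma K3_representation:
  assumes "f \<in> K3"
  obtains p where "p holomorphic_on ball 0 1" "p 0 = 1" "\<And>z. cmod z < 1 \<Longrightarrow> Re (p z) > 0"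
    "\<And>z. cmod z < 1 \<Longrightarrow> f z = z * p z / (1 - z\<^sup>2)"
proof -
  have f: "f holomorphic_on ball 0 1" "f 0 = 0" "deriv f 0 = 1"
    using assms by (auto simp: K3_def class_A_def)
  define q where "q = (\<lambda>z. if z = 0 then 1 else f z / z)"
  have "q holomorphic_on ball 0 1"
    \<comment> \<open>The singularity of \<open>f z / z\<close> at 0 is removable because
      \<open>f 0 = 0\<close>, and the value filled in is \<open>deriv f 0 = 1\<close>.\<close>
    by (rule pole_theorem_open_0[OF f(1), of 0]) (auto simp: q_def f)
  then have "(\<lambda>z. (1 - z\<^sup>2) * q z) holomorphic_on ball 0 1"
    by (intro holomorphic_intros)
  moreover have "Re ((1 - z\<^sup>2) * q z) > 0" if "cmod z < 1" for z
  proof (cases "z = 0")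
    case False
    then have "(1 - z\<^sup>2) * q z = (1 - z\<^sup>2) / z * f z" by (simp add: q_def)
    moreover have "Re ((1 - z\<^sup>2) / z * f z) > 0" using assms that False unfolding K3_def by force
    ultimately show ?thesis by (simp only:)
  qed (simp add: q_def)
  moreover have "f z = z * ((1 - z\<^sup>2) * q z) / (1 - z\<^sup>2)" if "cmod z < 1" for z
    using that f by (auto simp: q_def power2_eq_1_iff)
  ultimately show thesis by (intro that[of "\<lambda>z. (1 - z\<^sup>2) * q z"]) (auto simp: q_def)
qed

lemma has_deriv_K3_form:
  assumes p: "p holomorphic_on ball 0 1"
    and f: "\<And>z. cmod z < 1 \<Longrightarrow> f z = z * p z / (1 - z\<^sup>2)"
    and z: "cmod z < 1"
  shows "(f has_field_derivative
      ((p z + z * deriv p z) * (1 - z\<^sup>2) + 2 * z\<^sup>2 * p z) / (1 - z\<^sup>2)\<^sup>2) (at z)"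
proof -
  have nz: "1 - z\<^sup>2 \<noteq> 0" using z by (auto simp: power2_eq_1_iff)
  have dp: "(p has_field_derivative deriv p z) (at z)"
    using holomorphic_derivI[OF p] z by auto
  have "((\<lambda>z. z * p z / (1 - z\<^sup>2)) has_field_derivative
      ((p z + z * deriv p z) * (1 - z\<^sup>2) + 2 * z\<^sup>2 * p z) / (1 - z\<^sup>2)\<^sup>2) (at z)"
    using nz by (auto intro!: derivative_eq_intros dp simp: power2_eq_square algebra_simps)
  then show ?thesis
    by (rule has_field_derivative_transform_within_open[where S="ball 0 1"]) (use z f in auto)
qed

lemma log_quot_K3_form:
  assumes p: "p holomorphic_on ball 0 1" and nz: "p z \<noteq> 0"
    and f: "\<And>z. cmod z < 1 \<Longrightarrow> f z = z * p z / (1 - z\<^sup>2)"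
    and z: "cmod z < 1"
  shows "log_quot f z = (1 + z\<^sup>2) / (1 - z\<^sup>2) + z * deriv p z / p z"
proof (cases "z = 0")
  case False
  have "1 - z\<^sup>2 \<noteq> 0" using z by (auto simp: power2_eq_1_iff)
  moreover have "deriv f z = ((p z + z * deriv p z) * (1 - z\<^sup>2) + 2 * z\<^sup>2 * p z) / (1 - z\<^sup>2)\<^sup>2"
    by (intro DERIV_imp_deriv has_deriv_K3_form p f z)
  ultimately show ?thesis
    using False nz unfolding log_quot_def f[OF z]
    by (simp add: divide_simps) (simp add: power2_eq_square algebra_simps)
qed (auto simp: log_quot_def)

lemma K3_I:
  assumes p: "p holomorphic_on ball 0 1" and p0: "p 0 = 1"
    and pos: "\<And>z. cmod z < 1 \<Longrightarrow> Re (p z) > 0"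
  shows "(\<lambda>z. z * p z / (1 - z\<^sup>2)) \<in> K3"
proof -
  have nz: "1 - z\<^sup>2 \<noteq> 0" if "cmod z < 1" for z :: complex
    using that by (auto simp: power2_eq_1_iff)
  have "(\<lambda>z. z * p z / (1 - z\<^sup>2)) holomorphic_on ball 0 1"
    using nz by (intro holomorphic_intros p) auto
  moreover have "deriv (\<lambda>z. z * p z / (1 - z\<^sup>2)) 0 = 1"
    using DERIV_imp_deriv[OF has_deriv_K3_form[OF p refl, of 0]] p0 by simp
  ultimately show ?thesis using pos nz by (auto simp: K3_def class_A_def p0)
qed

text \<open>\<open>Re p > 0\<close> excludes zeros of \<open>f\<close> other than 0, so the quotient
  has no poles. \<open>subordinate\<close> demands this holomorphy explicitly.\<close>

lemma log_quot_K3_holomorphic: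
  assumes "f \<in> K3"
  shows "log_quot f holomorphic_on ball 0 1"
proof -
  obtain p where p: "p holomorphic_on ball 0 1" "p 0 = 1" "\<And>z. cmod z < 1 \<Longrightarrow> Re (p z) > 0"
    and f: "\<And>z. cmod z < 1 \<Longrightarrow> f z = z * p z / (1 - z\<^sup>2)"
    using K3_representation[OF assms] by blast
  have pnz: "p z \<noteq> 0" if "cmod z < 1" for z using p(3)[OF that] by auto
  have nz: "1 - z\<^sup>2 \<noteq> 0" if "cmod z < 1" for z :: complex
    using that by (auto simp: power2_eq_1_iff)
  have "(\<lambda>z. (1 + z\<^sup>2) / (1 - z\<^sup>2) + z * deriv p z / p z) holomorphic_on ball 0 1"
    using nz pnz by (intro holomorphic_intros p(1)) auto
  then show ?thesis
    by (rule holomorphic_transform) (auto simp: log_quot_K3_form[OF p(1) pnz f])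
qed

definition ctr :: "real \<Rightarrow> real" where "ctr r = (1 + r ^ 4) / (1 - r ^ 4)"

definition rad :: "real \<Rightarrow> real" where "rad r = 2 * r\<^sup>2 / (1 - r ^ 4) + 2 * r / (1 - r\<^sup>2)"

text \<open>The Cayley map sends the circle \<open>|w| = R\<close> to the circle whose diameter runs
  from \<open>(1 - R) / (1 + R)\<close> to \<open>(1 + R) / (1 - R)\<close>; centre and radius are
  read off from these endpoints. It is applied with \<open>R\<close> equal to
  \<open>r\<^sup>2\<close>.\<close>

lemma norm_Cayley_diff_le:
  fixes w :: complex
  assumes R: "0 \<le> R" "R < 1" and w: "cmod w \<le> R"
  shows "cmod ((1 + w) / (1 - w) - of_real ((1 + R\<^sup>2) / (1 - R\<^sup>2))) \<le> 2 * R / (1 - R\<^sup>2)"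
proof -
  have R2: "R\<^sup>2 < 1" using R by (simp add: abs_square_less_1)
  have w1: "1 - w \<noteq> 0" using R w by auto
  \<comment> \<open>Once the centre is subtracted, the claim becomes
    \<open>|w - R\<^sup>2| \<le> R |1 - w|\<close>, and \<open>|w| = R\<close> is exactly the
    Apollonius circle of this ratio.\<close>
  have "(cmod (w - of_real (R\<^sup>2)))\<^sup>2 - (R * cmod (1 - w))\<^sup>2 = (R\<^sup>2 - 1) * (R\<^sup>2 - (cmod w)\<^sup>2)"
    unfolding power_mult_distrib cmod_power2 by (simp add: power2_eq_square algebra_simps)
  also have "\<dots> \<le> 0"
    using R2 power_mono[OF w, of 2] by (intro mult_nonpos_nonneg) simp_all
  finally have "(cmod (w - of_real (R\<^sup>2)))\<^sup>2 \<le> (R * cmod (1 - w))\<^sup>2" by linarith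
  then have le: "cmod (w - of_real (R\<^sup>2)) \<le> R * cmod (1 - w)"
    by (rule power2_le_imp_le) (use R in simp)
  define S where "S = R\<^sup>2"
  have S: "S < 1" using R2 by (simp add: S_def)
  have cS: "1 - complex_of_real S = of_real (1 - S)" by simp
  have nS: "cmod (1 - of_real S) = 1 - S" unfolding cS norm_of_real using S by simp
  have cS0: "1 - complex_of_real S \<noteq> 0" unfolding cS of_real_eq_0_iff using S by simp
  have "of_real ((1 + S) / (1 - S)) = (1 + complex_of_real S) / (1 - complex_of_real S)" by simp
  also have "(1 + w) / (1 - w) - \<dots> = 2 * (w - of_real S) / ((1 - w) * (1 - of_real S))"
    using w1 cS0 by (simp add: divide_simps) (simp add: algebra_simps)
  finally have "cmod ((1 + w) / (1 - w) - of_real ((1 + S) / (1 - S)))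
      = 2 * cmod (w - of_real S) / (cmod (1 - w) * (1 - S))"
    by (simp only: norm_divide norm_mult nS norm_numeral)
  also have "\<dots> \<le> 2 * (R * cmod (1 - w)) / (cmod (1 - w) * (1 - S))"
    using le S by (intro divide_right_mono) (auto simp: S_def)
  also have "\<dots> = 2 * R / (1 - S)" using w1 by simp
  finally have "cmod ((1 + w) / (1 - w) - of_real ((1 + S) / (1 - S))) \<le> 2 * R / (1 - S)" .
  then show ?thesis by (simp only: S_def)
qed

lemma log_quot_K3_disc:
  assumes f: "f \<in> K3" and z: "cmod z < r" and r: "r < 1"
  shows "cmod (log_quot f z - of_real (ctr r)) < rad r"
proof -
  obtain p where p: "p holomorphic_on ball 0 1" "p 0 = 1" "\<And>z. cmod z < 1 \<Longrightarrow> Re (p z) > 0"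
    and fp: "\<And>z. cmod z < 1 \<Longrightarrow> f z = z * p z / (1 - z\<^sup>2)"
    using K3_representation[OF f] by blast
  have r0: "0 < r" using z norm_ge_zero[of z] by linarith
  have z1: "cmod z < 1" using z r by simp
  have pos: "Re (p z) > 0" by (rule p(3)[OF z1])
  then have pnz: "p z \<noteq> 0" by auto
  have r2: "r\<^sup>2 < 1" "(cmod z)\<^sup>2 < r\<^sup>2" "(cmod z)\<^sup>2 < 1"
    using r r0 z1 z by (auto simp: abs_square_less_1 intro!: power_strict_mono)
  have "cmod (deriv p z) * (1 - (cmod z)\<^sup>2) \<le> 2 * cmod (p z)"
    using norm_deriv_le_Re[OF p(1,3) z1] complex_Re_le_cmod[of "p z"] by linarith
  then have "cmod (deriv p z) / cmod (p z) \<le> 2 / (1 - (cmod z)\<^sup>2)"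
    using r2 pnz by (simp add: divide_simps mult.commute)
  also have "\<dots> \<le> 2 / (1 - r\<^sup>2)" using r2 by (intro divide_left_mono) auto
  finally have d: "cmod (deriv p z) / cmod (p z) \<le> 2 / (1 - r\<^sup>2)" .
  have "cmod (z * deriv p z / p z) = cmod z * (cmod (deriv p z) / cmod (p z))"
    by (simp add: norm_mult norm_divide)
  also have "\<dots> \<le> cmod z * (2 / (1 - r\<^sup>2))" by (rule mult_left_mono[OF d]) simp
  \<comment> \<open>The strict inequality arises here; it makes the value disc open, so that the
    critical radius itself is still admissible.\<close>
  also have "\<dots> < r * (2 / (1 - r\<^sup>2))" using z r2 by (intro mult_strict_right_mono) auto
  finally have A: "cmod (z * deriv p z / p z) < 2 * r / (1 - r\<^sup>2)" by (simp add: mult.commute)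
  have B: "cmod ((1 + z\<^sup>2) / (1 - z\<^sup>2) - of_real (ctr r)) \<le> 2 * r\<^sup>2 / (1 - r ^ 4)"
    using norm_Cayley_diff_le[of "r\<^sup>2" "z\<^sup>2"] r2 by (simp add: ctr_def norm_power)
  have "log_quot f z - of_real (ctr r)
      = ((1 + z\<^sup>2) / (1 - z\<^sup>2) - of_real (ctr r)) + z * deriv p z / p z"
    using log_quot_K3_form[of p z f, OF p(1) pnz fp z1] by simp
  then have "cmod (log_quot f z - of_real (ctr r)) \<le>
     cmod ((1 + z\<^sup>2) / (1 - z\<^sup>2) - of_real (ctr r)) + cmod (z * deriv p z / p z)"
    by (metis norm_triangle_ineq)
  with A B show ?thesis unfolding rad_def by linarith
qed

section \<open>Dilations, admissible radii and sharpness\<close>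

lemma log_quot_rescale:
  assumes "f holomorphic_on ball 0 1" "0 < r" "r \<le> 1" "cmod z < 1"
  shows "log_quot (\<lambda>z. f (of_real r * z) / of_real r) z = log_quot f (of_real r * z)"
    and "((\<lambda>z. f (of_real r * z) / of_real r) has_field_derivative deriv f (of_real r * z)) (at z)"
proof -
  have "r * cmod z < 1 * 1"
    using assms by (intro mult_le_less_imp_less) auto
  then have "(f has_field_derivative deriv f (of_real r * z)) (at (of_real r * z))"
    using assms by (intro holomorphic_derivI[of _ "ball 0 1"]) (auto simp: norm_mult)
  from DERIV_chain2[where g="\<lambda>z. of_real r * z", OF this, of "of_real r" UNIV]
  have "((\<lambda>z. f (of_real r * z)) has_field_derivative deriv f (of_real r * z) * of_real r) (at z)"
    by (auto intro!: derivative_eq_intros)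
  from DERIV_cdivide[OF this, of "of_real r"]
  show D: "((\<lambda>z. f (of_real r * z) / of_real r) has_field_derivative deriv f (of_real r * z)) (at z)"
    using assms by simp
  show "log_quot (\<lambda>z. f (of_real r * z) / of_real r) z = log_quot f (of_real r * z)"
    using assms by (simp add: log_quot_def DERIV_imp_deriv[OF D])
qed

lemma class_A_rescale:
  assumes f: "f \<in> class_A" and r: "0 < r" "r \<le> 1"
  shows "(\<lambda>z. f (of_real r * z) / of_real r) \<in> class_A"
proof -
  have h: "f holomorphic_on ball 0 1" "f 0 = 0" "deriv f 0 = 1"
    using f by (auto simp: class_A_def)
  let ?f = "\<lambda>z. f (of_real r * z) / of_real r"
  have D: "(?f has_field_derivative deriv f (of_real r * z)) (at z)" if "cmod z < 1" for z
    by (rule log_quot_rescale(2)[OF h(1) r that])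
  have "?f holomorphic_on ball 0 1"
    unfolding holomorphic_on_open[OF open_ball] using D by (metis mem_ball_0)
  then show ?thesis
    using DERIV_imp_deriv[OF D[of 0]] h by (simp add: class_A_def)
qed

lemma norm_scaled_less:
  assumes "0 < r" "r \<le> \<rho>" "cmod z < 1"
  shows "cmod (of_real r * z) < \<rho>"
proof -
  have "cmod (of_real r * z) = r * cmod z" using assms by (simp add: norm_mult)
  also have "\<dots> < r * 1" using assms by (intro mult_strict_left_mono) auto
  finally show ?thesis using assms by simp
qed

text \<open>The subordinating function is \<open>g\<close> after the rescaled quotient. Since the
  quotient is 1 at the origin, \<open>g 1 = 0\<close> yields the normalisation
  \<open>w 0 = 0\<close>.\<close>

lemma admissible_S_star:
  assumes \<rho>: "\<rho> < 1"
    and B: "\<And>f z. f \<in> K3 \<Longrightarrow> cmod z < \<rho> \<Longrightarrow> log_quot f z \<in> B"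
    and h: "h holomorphic_on ball 0 1" and g: "g holomorphic_on B"
    and gB: "\<And>q. q \<in> B \<Longrightarrow> cmod (g q) < 1"
    and hg: "\<And>q. q \<in> B \<Longrightarrow> h (g q) = q" and g1: "g 1 = 0"
  shows "admissible_radius K3 (S_star h) \<rho>"
  unfolding admissible_radius_def
proof (intro conjI ballI allI impI)
  fix f r assume f: "f \<in> K3" and r: "0 < r \<and> r \<le> \<rho>"
  let ?f = "\<lambda>z. f (of_real r * z) / of_real r"
  have fA: "f \<in> class_A" using f by (simp add: K3_def)
  then have fh: "f holomorphic_on ball 0 1" by (simp add: class_A_def)
  have lq: "log_quot ?f z = log_quot f (of_real r * z)" if "cmod z < 1" for z
    using log_quot_rescale(1)[OF fh] r \<rho> that by auto
  have inB: "log_quot f (of_real r * z) \<in> B" if "cmod z < 1" for z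
    using B[OF f] norm_scaled_less[of r \<rho> z] r that by auto
  have h0: "(\<lambda>z. log_quot f (of_real r * z)) holomorphic_on ball 0 1"
  proof -
    have "(\<lambda>z. of_real r * z) holomorphic_on ball 0 1" by (intro holomorphic_intros)
    from holomorphic_on_compose_gen[OF this log_quot_K3_holomorphic[OF f]] show ?thesis
      using norm_scaled_less[of r 1] r \<rho> by (auto simp: o_def image_subset_iff)
  qed
  then have "log_quot ?f holomorphic_on ball 0 1"
    by (rule holomorphic_transform) (auto simp: lq)
  moreover have "(\<lambda>z. g (log_quot f (of_real r * z))) holomorphic_on ball 0 1"
    using holomorphic_on_compose_gen[OF h0 g] inB by (auto simp: o_def image_subset_iff)
  ultimately have "subordinate (log_quot ?f) h"
    unfolding subordinate_def using h gB inB hg g1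
    by (intro conjI exI[of _ "\<lambda>z. g (log_quot f (of_real r * z))"])
       (auto simp: lq, simp add: log_quot_def)
  then show "?f \<in> S_star h"
    using class_A_rescale[OF fA] r \<rho> by (simp add: S_star_def)
qed (use \<rho> in simp)

text \<open>If a larger \<open>\<rho>'\<close> were admissible, the dilation of \<open>F\<close> by
  \<open>\<rho>'\<close> would lie in \<open>H\<close> and take the forbidden value
  \<open>log_quot F a\<close> at the interior point \<open>a / \<rho>'\<close>.\<close>

lemma is_sharp_radius_K3_I:
  assumes adm: "admissible_radius K3 H \<rho>" and F: "F \<in> K3" and a: "cmod a = \<rho>" "0 < \<rho>"
    and ne: "\<And>G z. G \<in> H \<Longrightarrow> cmod z < 1 \<Longrightarrow> log_quot G z \<noteq> log_quot F a"
  shows "is_sharp_radius K3 H \<rho>"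
  unfolding is_sharp_radius_def
proof (intro conjI allI impI adm)
  fix \<rho>' assume \<rho>': "admissible_radius K3 H \<rho>'"
  show "\<rho>' \<le> \<rho>"
  proof (rule ccontr)
    assume "\<not> \<rho>' \<le> \<rho>"
    then have l: "\<rho> < \<rho>'" "0 < \<rho>'" "\<rho>' \<le> 1" using a \<rho>' by (auto simp: admissible_radius_def)
    have H: "(\<lambda>z. F (of_real \<rho>' * z) / of_real \<rho>') \<in> H"
      using \<rho>' F l by (auto simp: admissible_radius_def)
    have z: "cmod (a / of_real \<rho>') < 1" using a l by (simp add: norm_divide)
    have "F holomorphic_on ball 0 1" using F by (simp add: K3_def class_A_def)
    then show False
      using ne[OF H z] log_quot_rescale(1)[of F \<rho>' "a / of_real \<rho>'"] l z by simp
  qed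
qed

section \<open>Extremal functions and the radius equation\<close>

text \<open>The factor \<open>(1 + u z) / (1 - u z)\<close> maps onto the right half-plane. The
  rotation \<open>u\<close> makes \<open>u * z\<close> real at the point where the first summand of
  the quotient is extreme, so that both summands are extreme there in the same direction.\<close>

definition extremal :: "complex \<Rightarrow> complex \<Rightarrow> complex" where
  "extremal u z = z * ((1 + u * z) / (1 - u * z)) / (1 - z\<^sup>2)"

lemma extremal_K3:
  assumes u: "cmod u = 1"
  shows "extremal u \<in> K3"
    and "cmod z < 1 \<Longrightarrow> log_quot (extremal u) z = (1 + z\<^sup>2) / (1 - z\<^sup>2) + 2 * (u * z) / (1 - (u * z)\<^sup>2)"
proof -
  let ?p = "\<lambda>z. (1 + u * z) / (1 - u * z)"
  have uz: "cmod (u * z) < 1" if "cmod z < 1" for z using that u by (simp add: norm_mult)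
  have nz: "1 - u * z \<noteq> 0" "1 + u * z \<noteq> 0" if "cmod z < 1" for z
    using uz[OF that] by (auto, metis add_eq_0_iff norm_minus_cancel norm_one order_less_irrefl)
  have hol: "?p holomorphic_on ball 0 1"
    using nz by (intro holomorphic_intros) auto
  have pos: "Re (?p z) > 0" if "cmod z < 1" for z
  proof -
    let ?w = "u * z"
    have "(cmod ?w)\<^sup>2 < 1" using uz[OF that] by (simp add: abs_square_less_1)
    then have "Re ((1 + ?w) * cnj (1 - ?w)) > 0"
      unfolding cmod_power2 by (simp add: power2_eq_square algebra_simps)
    then show ?thesis using nz(1)[OF that] by (simp add: Re_complex_div_gt_0)
  qed
  show "extremal u \<in> K3"
    using K3_I[OF hol _ pos] by (simp add: extremal_def[abs_def])
  assume z: "cmod z < 1"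
  have "(?p has_field_derivative 2 * u / (1 - u * z)\<^sup>2) (at z)"
    using nz[OF z] by (auto intro!: derivative_eq_intros simp: power2_eq_square algebra_simps)
  then have d: "deriv ?p z = 2 * u / (1 - u * z)\<^sup>2" by (rule DERIV_imp_deriv)
  have "log_quot (extremal u) z = (1 + z\<^sup>2) / (1 - z\<^sup>2) + z * deriv ?p z / ?p z"
    by (rule log_quot_K3_form[OF hol]) (use nz[OF z] z in \<open>auto simp: extremal_def\<close>)
  moreover have "z * deriv ?p z / ?p z = 2 * (u * z) / ((1 - u * z) * (1 + u * z))"
    unfolding d using nz[OF z] by (simp add: divide_simps) (simp add: power2_eq_square algebra_simps)
  moreover have "(1 - u * z) * (1 + u * z) = 1 - (u * z)\<^sup>2" by (simp add: power2_eq_square algebra_simps)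
  ultimately show "log_quot (extremal u) z = (1 + z\<^sup>2) / (1 - z\<^sup>2) + 2 * (u * z) / (1 - (u * z)\<^sup>2)"
    by simp
qed

lemma power4_eq: "(x::'a::comm_ring_1) ^ 4 = (x\<^sup>2)\<^sup>2"
  by simp

lemma power4_less_1: "0 \<le> r \<Longrightarrow> r < 1 \<Longrightarrow> (r::real) ^ 4 < 1"
  by (simp add: power_less_one_iff)

lemma ctr_plus_rad:
  assumes r: "0 \<le> r" "r < 1"
  shows "ctr r + rad r = (1 + r) / (1 - r)"
proof -
  have r2: "1 - r\<^sup>2 \<noteq> 0" "1 + r\<^sup>2 \<noteq> 0" using r abs_square_less_1[of r]
    by (auto simp: add_nonneg_eq_0_iff)
  have e: "1 - r ^ 4 = (1 - r\<^sup>2) * (1 + r\<^sup>2)" unfolding power4_eq by (simp add: power2_eq_square algebra_simps)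
  have "ctr r + rad r = ((1 + r ^ 4) + 2 * r\<^sup>2) / (1 - r ^ 4) + 2 * r / (1 - r\<^sup>2)"
    by (simp add: ctr_def rad_def add_divide_distrib)
  also have "(1 + r ^ 4) + 2 * r\<^sup>2 = (1 + r\<^sup>2) * (1 + r\<^sup>2)"
    unfolding power4_eq by (simp add: power2_eq_square algebra_simps)
  also have "(1 + r\<^sup>2) * (1 + r\<^sup>2) / (1 - r ^ 4) = (1 + r\<^sup>2) / (1 - r\<^sup>2)"
    unfolding e using r2 by simp
  also have "\<dots> + 2 * r / (1 - r\<^sup>2) = (1 + r) * (1 + r) / ((1 - r) * (1 + r))"
    by (simp add: power2_eq_square algebra_simps flip: add_divide_distrib)
  also have "\<dots> = (1 + r) / (1 - r)" using r by simp
  finally show ?thesis .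
qed

lemma ctr_minus_rad:
  assumes r: "0 \<le> r" "r < 1"
  shows "ctr r - rad r = (1 - r\<^sup>2) / (1 + r\<^sup>2) - 2 * r / (1 - r\<^sup>2)"
proof -
  have r2: "1 - r\<^sup>2 \<noteq> 0" "1 + r\<^sup>2 \<noteq> 0" using r abs_square_less_1[of r]
    by (auto simp: add_nonneg_eq_0_iff)
  have e: "1 - r ^ 4 = (1 - r\<^sup>2) * (1 + r\<^sup>2)" unfolding power4_eq by (simp add: power2_eq_square algebra_simps)
  have "ctr r - rad r = ((1 + r ^ 4) - 2 * r\<^sup>2) / (1 - r ^ 4) - 2 * r / (1 - r\<^sup>2)"
    by (simp add: ctr_def rad_def diff_divide_distrib)
  also have "(1 + r ^ 4) - 2 * r\<^sup>2 = (1 - r\<^sup>2) * (1 - r\<^sup>2)"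
    unfolding power4_eq by (simp add: power2_eq_square algebra_simps)
  also have "(1 - r\<^sup>2) * (1 - r\<^sup>2) / (1 - r ^ 4) = (1 - r\<^sup>2) / (1 + r\<^sup>2)"
    unfolding e using r2 by simp
  finally show ?thesis .
qed

lemma ctr_ge_1: "0 \<le> r \<Longrightarrow> r < 1 \<Longrightarrow> ctr r \<ge> 1"
  using power4_less_1[of r] by (simp add: ctr_def)

text \<open>Because \<open>ctr r \<ge> 1\<close>, the disc about 1 through the same rightmost point
  \<open>(1 + r) / (1 - r)\<close> contains the value disc. This form suits the targets whose
  critical point lies on the right.\<close>

lemma log_quot_K3_near_1:
  assumes f: "f \<in> K3" and z: "cmod z < r" and r: "r < 1"
  shows "cmod (log_quot f z - 1) < 2 * r / (1 - r)"
proof -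
  have r0: "0 \<le> r" using z norm_ge_zero[of z] by linarith
  have "cmod (log_quot f z - 1) \<le> cmod (log_quot f z - of_real (ctr r)) + cmod (of_real (ctr r - 1))"
    using norm_triangle_ineq[of "log_quot f z - of_real (ctr r)" "of_real (ctr r - 1)"] by simp
  also have "cmod (of_real (ctr r - 1)) = ctr r - 1"
    unfolding norm_of_real using ctr_ge_1[OF r0 r] by simp
  also have "cmod (log_quot f z - of_real (ctr r)) + (ctr r - 1) < rad r + ctr r - 1"
    using log_quot_K3_disc[OF f z r] by simp
  also have "\<dots> = (1 + r) / (1 - r) - 1" using ctr_plus_rad[OF r0 r] by simp
  also have "\<dots> = 2 * r / (1 - r)" using r by (simp add: field_simps)
  finally show ?thesis .
qed

lemma extremal_value_upper:
  assumes r: "0 \<le> r" "r < 1"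
  shows "log_quot (extremal 1) (of_real r) = of_real ((1 + r) / (1 - r))"
proof -
  have "log_quot (extremal 1) (of_real r) = of_real ((1 + r\<^sup>2) / (1 - r\<^sup>2) + 2 * r / (1 - r\<^sup>2))"
    using extremal_K3(2)[of 1 "of_real r"] r by simp
  also have "(1 + r\<^sup>2) / (1 - r\<^sup>2) + 2 * r / (1 - r\<^sup>2) = (1 + r) * (1 + r) / ((1 - r) * (1 + r))"
    by (simp add: power2_eq_square algebra_simps flip: add_divide_distrib)
  also have "\<dots> = (1 + r) / (1 - r)" using r by simp
  finally show ?thesis .
qed

lemma extremal_value_lower:
  assumes r: "0 \<le> r" "r < 1"
  shows "log_quot (extremal \<i>) (\<i> * of_real r) = of_real (ctr r - rad r)"
proof -
  have "\<i> * (\<i> * complex_of_real r) = - of_real r" by (simp flip: mult.assoc)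
  then show ?thesis
    using extremal_K3(2)[of \<i> "\<i> * of_real r"] r
    by (simp add: norm_mult ctr_minus_rad[OF r] power_mult_distrib)
qed

section \<open>The radius equation\<close>

text \<open>This is the numerator of \<open>ctr r - rad r - c\<close> over the denominator
  \<open>1 - r ^ 4\<close>.\<close>

definition radius_poly :: "real \<Rightarrow> real \<Rightarrow> real" where
  "radius_poly c r = (1 + c) * r ^ 4 - 2 * r * (r\<^sup>2 + r + 1) + (1 - c)"

text \<open>On the unit interval the slopes of \<open>r ^ 4\<close> stay below those of
  \<open>r ^ 3 + r\<^sup>2 + r\<close>, and \<open>1 + c \<le> 2\<close>. Monotonicity makes the
  root in the interval unique and lets signs locate it.\<close>

lemma radius_poly_strict_antimono:
  assumes c: "c \<le> 1" and r: "0 \<le> r" "r < s" "s \<le> 1"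
  shows "radius_poly c s < radius_poly c r"
proof -
  have s4: "s ^ 4 - r ^ 4 = (s - r) * (s ^ 3 + s\<^sup>2 * r + s * r\<^sup>2 + r ^ 3)"
    by (simp add: power2_eq_square power3_eq_cube power4_eq_xxxx algebra_simps)
  have "(1 + c) * (s ^ 4 - r ^ 4) \<le> 2 * (s ^ 4 - r ^ 4)"
    using c r by (intro mult_right_mono) (auto intro: power_mono)
  also have "s ^ 3 + s\<^sup>2 * r + s * r\<^sup>2 + r ^ 3 < s\<^sup>2 + s * r + r\<^sup>2 + s + r + 1"
  proof -
    have "s\<^sup>2 * s \<le> s\<^sup>2 * 1" "s\<^sup>2 * r \<le> s\<^sup>2 * 1" "s * r\<^sup>2 \<le> 1 * r\<^sup>2" "r\<^sup>2 * r \<le> r\<^sup>2 * 1"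
      using r by (intro mult_left_mono mult_right_mono; simp)+
    moreover have "s\<^sup>2 \<le> s * 1" "r\<^sup>2 \<le> r * 1"
      unfolding power2_eq_square using r by (intro mult_left_mono; simp)+
    moreover have "0 \<le> s * r" using r by simp
    moreover have "s ^ 3 = s\<^sup>2 * s" "r ^ 3 = r\<^sup>2 * r" by (simp_all add: power2_eq_square power3_eq_cube)
    ultimately show ?thesis using r by linarith
  qed
  then have "2 * (s ^ 4 - r ^ 4) < 2 * ((s - r) * (s\<^sup>2 + s * r + r\<^sup>2 + s + r + 1))"
    unfolding s4 using r by simp
  finally have "(1 + c) * (s ^ 4 - r ^ 4) < 2 * ((s - r) * (s\<^sup>2 + s * r + r\<^sup>2 + s + r + 1))" .
  then show ?thesis
    by (simp add: radius_poly_def power2_eq_square algebra_simps)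
qed

lemma radius_poly_root:
  assumes c: "c < 1"
  obtains \<rho> where "0 < \<rho>" "\<rho> < 1" "radius_poly c \<rho> = 0"
proof -
  have v: "radius_poly c 0 > 0" "radius_poly c 1 < 0" using c by (auto simp: radius_poly_def)
  have "continuous_on {0..1} (radius_poly c)"
    unfolding radius_poly_def by (intro continuous_intros)
  then obtain \<rho> where "0 \<le> \<rho>" "\<rho> \<le> 1" "radius_poly c \<rho> = 0"
    using IVT2'[of "radius_poly c" 1 0 0] v by auto
  moreover from this v have "\<rho> \<noteq> 0" "\<rho> \<noteq> 1" by auto
  ultimately show thesis by (intro that[of \<rho>]) auto
qed

text \<open>The factor \<open>k\<close> absorbs the different normalisations of the equations. Only
  roots below \<open>\<rho>\<close> have to be excluded, and there monotonicity applies.\<close>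

lemma smallest_pos_root_radius_poly:
  assumes c: "c \<le> 1" and \<rho>: "0 < \<rho>" "\<rho> \<le> 1" "radius_poly c \<rho> = 0"
    and g: "\<And>r. g r = k * radius_poly c r" and k: "k \<noteq> 0"
  shows "smallest_pos_root g \<rho>"
  unfolding smallest_pos_root_def
proof (intro conjI allI impI)
  fix r assume r: "0 < r \<and> g r = 0"
  show "\<rho> \<le> r"
  proof (rule ccontr)
    assume "\<not> \<rho> \<le> r"
    then show False using radius_poly_strict_antimono[OF c, of r \<rho>] r \<rho> g k by simp
  qed
qed (use \<rho> g in auto)

lemma radius_poly_root_less:
  assumes "c \<le> 1" "0 \<le> \<rho>" "\<rho> \<le> 1" "radius_poly c \<rho> = 0" "0 \<le> s" "radius_poly c s < 0"
  shows "\<rho> < s"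
proof (rule ccontr)
  assume "\<not> \<rho> < s"
  then show False using radius_poly_strict_antimono[of c s \<rho>] assms by (cases "s = \<rho>") auto
qed

lemma radius_poly_root_greater:
  assumes "c \<le> 1" "0 \<le> \<rho>" "\<rho> \<le> 1" "radius_poly c \<rho> = 0" "s \<le> 1" "radius_poly c s > 0"
  shows "s < \<rho>"
proof (rule ccontr)
  assume "\<not> s < \<rho>"
  then show False using radius_poly_strict_antimono[of c \<rho> s] assms by (cases "s = \<rho>") auto
qed

lemma radius_poly_root_value:
  assumes "0 \<le> \<rho>" "\<rho> < 1" "radius_poly c \<rho> = 0"
  shows "ctr \<rho> - rad \<rho> = c"
proof -
  have p: "1 - \<rho> ^ 4 > 0" using power4_less_1[of \<rho>] assms by simp
  have e: "1 - \<rho> ^ 4 = (1 - \<rho>\<^sup>2) * (1 + \<rho>\<^sup>2)"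
    unfolding power4_eq by (simp add: power2_eq_square algebra_simps)
  then have n: "1 - \<rho>\<^sup>2 \<noteq> 0" "1 + \<rho>\<^sup>2 \<noteq> 0" using p by auto
  have "2 * \<rho> / (1 - \<rho>\<^sup>2) = 2 * \<rho> * (1 + \<rho>\<^sup>2) / (1 - \<rho> ^ 4)"
    unfolding e using n by simp
  then have "ctr \<rho> - rad \<rho> = (1 + \<rho> ^ 4 - 2 * \<rho>\<^sup>2 - 2 * \<rho> * (1 + \<rho>\<^sup>2)) / (1 - \<rho> ^ 4)"
    by (simp add: ctr_def rad_def diff_divide_distrib)
  also have "1 + \<rho> ^ 4 - 2 * \<rho>\<^sup>2 - 2 * \<rho> * (1 + \<rho>\<^sup>2) = c * (1 - \<rho> ^ 4)"
    using assms(3) by (simp add: radius_poly_def power2_eq_square algebra_simps)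
  finally show ?thesis using p by simp
qed

lemma log_quot_K3_Re_greater:
  assumes "0 \<le> \<rho>" "\<rho> < 1" "radius_poly c \<rho> = 0" "f \<in> K3" "cmod z < \<rho>"
  shows "Re (log_quot f z) > c"
  using log_quot_K3_disc[of f z \<rho>] radius_poly_root_value[of \<rho> c] assms
    abs_Re_le_cmod[of "log_quot f z - of_real (ctr \<rho>)"] by simp

text \<open>For \<open>c \<ge> 1/3\<close> the centre \<open>ctr \<rho>\<close> is so close to \<open>1\<close> that discs with any centre
  \<open>a \<ge> 11/10\<close> touching the line \<open>Re w = c\<close> from the right contain the value region.\<close>

lemma log_quot_K3_in_ball:
  assumes c: "1 / 3 \<le> c" "c < 1" and \<rho>: "0 < \<rho>" "\<rho> < 1" "radius_poly c \<rho> = 0"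
    and f: "f \<in> K3" and z: "cmod z < \<rho>" and a: "11 / 10 \<le> a"
  shows "log_quot f z \<in> ball (of_real a) (a - c)"
proof -
  \<comment> \<open>At a fixed \<open>r\<close> in the unit interval the polynomial decreases in
    \<open>c\<close>, so the cardioid value \<open>c = 1/3\<close> is the worst case. The bound
    \<open>3/10\<close> is generous but keeps the centre below \<open>11/10\<close>.\<close>
  have "radius_poly c (3 / 10) < 0" using c by (simp add: radius_poly_def power2_eq_square power4_eq_xxxx field_simps)
  then have "\<rho> < 3 / 10" using radius_poly_root_less[of c \<rho> "3/10"] c \<rho> by simp
  then have "\<rho> ^ 4 \<le> (3 / 10) ^ 4" using \<rho> by (intro power_mono) auto
  then have "ctr \<rho> \<le> 11 / 10" by (simp add: ctr_def power4_eq_xxxx divide_simps)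
  then have "cmod (of_real (a - ctr \<rho>)) = a - ctr \<rho>" unfolding norm_of_real using a by simp
  then have "cmod (of_real a - log_quot f z) \<le> (a - ctr \<rho>) + cmod (log_quot f z - of_real (ctr \<rho>))"
    using norm_triangle_ineq4[of "of_real (a - ctr \<rho>)" "log_quot f z - of_real (ctr \<rho>)"] by simp
  also have "\<dots> < (a - ctr \<rho>) + rad \<rho>" using log_quot_K3_disc[OF f z] \<rho> by simp
  finally show ?thesis using radius_poly_root_value[of \<rho> c] \<rho> by (simp add: dist_norm)
qed

lemma S_star_value:
  assumes "G \<in> S_star h" "cmod z < 1"
  obtains w where "cmod w < 1" "log_quot G z = h w"
proof -
  obtain w where "w ` ball 0 1 \<subseteq> ball 0 1" "\<forall>z\<in>ball 0 1. log_quot G z = h (w z)"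
    using assms(1) by (auto simp: S_star_def subordinate_def)
  with assms(2) show thesis by (intro that[of "w z"]) (auto simp: image_subset_iff)
qed

lemma sharp_lower:
  assumes "admissible_radius K3 H \<rho>" "0 < \<rho>" "\<rho> < 1" "radius_poly c \<rho> = 0"
    and "\<And>G z. G \<in> H \<Longrightarrow> cmod z < 1 \<Longrightarrow> log_quot G z \<noteq> of_real c"
  shows "is_sharp_radius K3 H \<rho>"
  by (rule is_sharp_radius_K3_I[OF assms(1) extremal_K3(1)[of \<i>], of "\<i> * of_real \<rho>"])
     (use assms in \<open>auto simp: norm_mult extremal_value_lower radius_poly_root_value\<close>)

lemma sharp_upper:
  assumes "admissible_radius K3 H \<rho>" "0 < \<rho>" "\<rho> < 1"
    and "\<And>G z. G \<in> H \<Longrightarrow> cmod z < 1 \<Longrightarrow> log_quot G z \<noteq> of_real ((1 + \<rho>) / (1 - \<rho>))"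
  shows "is_sharp_radius K3 H \<rho>"
  by (rule is_sharp_radius_K3_I[OF assms(1) extremal_K3(1)[of 1], of "of_real \<rho>"])
     (use assms in \<open>simp_all add: extremal_value_upper del: of_real_divide of_real_add of_real_diff\<close>)

lemma admissible_pointwise:
  assumes \<rho>: "\<rho> < 1"
    and B: "\<And>f z. f \<in> K3 \<Longrightarrow> cmod z < \<rho> \<Longrightarrow> Q (log_quot f z)"
  shows "admissible_radius K3 {f \<in> class_A. \<forall>z\<in>ball 0 1. Q (log_quot f z)} \<rho>"
  unfolding admissible_radius_def
proof (intro conjI ballI allI impI)
  fix f r assume f: "f \<in> K3" and r: "0 < r \<and> r \<le> \<rho>"
  have fA: "f \<in> class_A" using f by (simp add: K3_def)
  then have fh: "f holomorphic_on ball 0 1" by (simp add: class_A_def)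
  show "(\<lambda>z. f (of_real r * z) / of_real r) \<in> {f \<in> class_A. \<forall>z\<in>ball 0 1. Q (log_quot f z)}"
    using class_A_rescale[OF fA] log_quot_rescale(1)[OF fh, of r] B[OF f] norm_scaled_less[of r \<rho>] r \<rho>
    by auto
qed (use \<rho> in simp)

section \<open>Discs inside the target regions\<close>

text \<open>The modulus cannot cross 1 on a connected set. For an inverse branch \<open>g\<close> of
  \<open>h\<close> this reduces \<open>|g| < 1\<close> to a statement about the unit circle:
  \<open>|g q| = 1\<close> would place \<open>q = h (g q)\<close> on the image of that
  circle.\<close>

lemma connected_norm_less_1:
  fixes g :: "complex \<Rightarrow> complex"
  assumes "connected B" "continuous_on B g" "q0 \<in> B" "cmod (g q0) < 1"
    and ne: "\<And>q. q \<in> B \<Longrightarrow> cmod (g q) \<noteq> 1" and q: "q \<in> B"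
  shows "cmod (g q) < 1"
proof (rule ccontr)
  assume "\<not> cmod (g q) < 1"
  moreover have "connected ((\<lambda>q. cmod (g q)) ` B)"
    using assms by (intro connected_continuous_image continuous_intros)
  ultimately have "1 \<in> (\<lambda>q. cmod (g q)) ` B"
    using connected_contains_Icc[of _ "cmod (g q0)" "cmod (g q)"] assms by fastforce
  then show False using ne by auto
qed

lemma Re_pos_notin_nonpos_Reals: "Re z > 0 \<Longrightarrow> z \<notin> \<real>\<^sub>\<le>\<^sub>0"
  by (auto simp: complex_nonpos_Reals_iff)

lemma Re_csqrt_pos: "Re z > 0 \<Longrightarrow> Re (csqrt z) > 0"
  by (simp add: add_nonneg_pos)

lemma ball_of_realD:
  assumes "q \<in> ball (of_real a) d"
  shows "cmod (q - of_real a) < d" "a - d < Re q"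
  using assms abs_Re_le_cmod[of "q - of_real a"] by (auto simp: dist_norm norm_minus_commute)

lemma admissible_S_star_lower:
  assumes c: "1 / 3 \<le> c" "c < 1" and \<rho>: "0 < \<rho>" "\<rho> < 1" "radius_poly c \<rho> = 0" and a: "11 / 10 \<le> a"
    and h: "h holomorphic_on ball 0 1" and g: "g holomorphic_on ball (of_real a) (a - c)"
    and gB: "\<And>q. q \<in> ball (of_real a) (a - c) \<Longrightarrow> cmod (g q) < 1"
    and hg: "\<And>q. q \<in> ball (of_real a) (a - c) \<Longrightarrow> h (g q) = q" and g1: "g 1 = 0"
  shows "admissible_radius K3 (S_star h) \<rho>"
  by (rule admissible_S_star[OF \<rho>(2) log_quot_K3_in_ball[OF c \<rho> _ _ a] h g gB hg g1])

lemma sharp_S_star_lower: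
  assumes "admissible_radius K3 (S_star h) \<rho>" "0 < \<rho>" "\<rho> < 1" "radius_poly c \<rho> = 0"
    and ne: "\<And>w. cmod w < 1 \<Longrightarrow> h w \<noteq> of_real c"
  shows "is_sharp_radius K3 (S_star h) \<rho>"
  by (rule sharp_lower[OF assms(1-4)]) (use ne in \<open>metis S_star_value\<close>)

lemma sharp_S_star_upper:
  assumes "admissible_radius K3 (S_star h) \<rho>" "0 < \<rho>" "\<rho> < 1"
    and ne: "\<And>w. cmod w < 1 \<Longrightarrow> h w \<noteq> of_real ((1 + \<rho>) / (1 - \<rho>))"
  shows "is_sharp_radius K3 (S_star h) \<rho>"
  by (rule sharp_upper[OF assms(1-3)]) (use ne in \<open>metis S_star_value\<close>)

section \<open>Half-planes, the parabola and the lemniscate\<close>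

lemma sharp_starlike:
  assumes "0 < \<rho>" "\<rho> < 1" "radius_poly \<alpha> \<rho> = 0"
  shows "is_sharp_radius K3 (starlike_of_order \<alpha>) \<rho>"
proof (rule sharp_lower[OF _ assms])
  show "admissible_radius K3 (starlike_of_order \<alpha>) \<rho>"
    unfolding starlike_of_order_def using assms log_quot_K3_Re_greater[of \<rho> \<alpha>]
    by (intro admissible_pointwise) auto
  show "log_quot G z \<noteq> of_real \<alpha>" if "G \<in> starlike_of_order \<alpha>" "cmod z < 1" for G z
  proof -
    have "Re (log_quot G z) > \<alpha>" using that by (simp add: starlike_of_order_def)
    then show ?thesis by auto
  qed
qed

lemma sharp_S_P:
  assumes \<rho>: "0 < \<rho>" "\<rho> < 1" "radius_poly (1 / 2) \<rho> = 0"
  shows "is_sharp_radius K3 S_P \<rho>"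
proof (rule sharp_lower[OF _ \<rho>])
  \<comment> \<open>The centre \<open>3/2\<close> with radius 1 gives the osculating circle of the
    parabola at its vertex \<open>1/2\<close>.\<close>
  have "(Im q)\<^sup>2 < 2 * Re q - 1" if "q \<in> ball (of_real (3 / 2)) (3 / 2 - 1 / 2)" for q
  proof -
    have "cmod (q - of_real (3 / 2)) < 1" using ball_of_realD(1)[OF that] by simp
    then have "(cmod (q - of_real (3 / 2)))\<^sup>2 < 1" by (simp add: abs_square_less_1)
    then have "(Re q - 3 / 2)\<^sup>2 + (Im q)\<^sup>2 < 1" unfolding cmod_power2 by simp
    moreover have "1 - (Re q - 3 / 2)\<^sup>2 = 2 * Re q - 1 - (Re q - 1 / 2)\<^sup>2"
      by (simp add: power2_eq_square field_simps)
    moreover have "0 \<le> (Re q - 1 / 2)\<^sup>2" by simp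
    ultimately show ?thesis by linarith
  qed
  then show "admissible_radius K3 S_P \<rho>"
    unfolding S_P_def using log_quot_K3_in_ball[OF _ _ \<rho>, of _ _ "3 / 2"] \<rho>
    by (intro admissible_pointwise) auto
  show "log_quot G z \<noteq> of_real (1 / 2)" if "G \<in> S_P" "cmod z < 1" for G z
  proof
    assume "log_quot G z = of_real (1 / 2)"
    then have "Im (log_quot G z) = 0" "Re (log_quot G z) = 1 / 2"
      by (simp_all only: Re_complex_of_real Im_complex_of_real)
    moreover have "(Im (log_quot G z))\<^sup>2 < 2 * Re (log_quot G z) - 1"
      using that by (simp add: S_P_def)
    ultimately show False by simp
  qed
qed

lemma sharp_S_L: "is_sharp_radius K3 S_L ((sqrt 2 - 1) / (sqrt 2 + 1))"
proof -
  define \<rho> :: real where "\<rho> = (sqrt 2 - 1) / (sqrt 2 + 1)"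
  have s2: "sqrt 2 * sqrt 2 = 2" by simp
  have pos: "sqrt 2 + 1 > 0" by (intro add_nonneg_pos) simp_all
  then have ne: "1 + sqrt 2 \<noteq> 0" by linarith
  from pos have \<rho>: "0 < \<rho>" "\<rho> < 1" by (simp_all add: \<rho>_def divide_simps)
  \<comment> \<open>The radius solves \<open>(1 + \<rho>) / (1 - \<rho>) = sqrt 2\<close>, the
    right-hand boundary point \<open>h 1\<close>.\<close>
  have v: "(1 + \<rho>) / (1 - \<rho>) = sqrt 2" "2 * \<rho> / (1 - \<rho>) = sqrt 2 - 1"
    using pos ne by (auto simp add: \<rho>_def divide_simps)
  have re: "Re q > 0" if "q \<in> ball 1 (sqrt 2 - 1)" for q
    using ball_of_realD(2)[of q 1 "sqrt 2 - 1"] that sqrt2_less_2 by simp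
  have "admissible_radius K3 S_L \<rho>"
    unfolding S_L_def
  proof (rule admissible_S_star[where g="\<lambda>q. q\<^sup>2 - 1" and B="ball 1 (sqrt 2 - 1)"])
    show "log_quot f z \<in> ball 1 (sqrt 2 - 1)" if "f \<in> K3" "cmod z < \<rho>" for f z
      using log_quot_K3_near_1[OF that \<rho>(2)] v by (simp add: dist_norm norm_minus_commute)
    show "(\<lambda>z. csqrt (1 + z)) holomorphic_on ball 0 1"
    proof (intro holomorphic_intros Re_pos_notin_nonpos_Reals)
      show "0 < Re (1 + z)" if "z \<in> ball 0 1" for z
        using that abs_Re_le_cmod[of z] by simp
    qed
    show "cmod (q\<^sup>2 - 1) < 1" if q: "q \<in> ball 1 (sqrt 2 - 1)" for q
    proof -
      have a: "cmod (q - 1) < sqrt 2 - 1" using ball_of_realD(1)[of q 1] q by simp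
      then have b: "cmod (q + 1) < sqrt 2 + 1"
        using norm_triangle_ineq[of "q - 1" 2] by (simp add: add.commute)
      have "q\<^sup>2 - 1 = (q - 1) * (q + 1)" by (simp add: power2_eq_square algebra_simps)
      then have "cmod (q\<^sup>2 - 1) = cmod (q - 1) * cmod (q + 1)" by (simp add: norm_mult)
      also have "\<dots> < (sqrt 2 - 1) * (sqrt 2 + 1)"
        using a b by (intro mult_strict_mono') auto
      finally show ?thesis by (simp add: algebra_simps)
    qed
    \<comment> \<open>Squaring is undone by the principal root because the disc lies in the right
      half-plane.\<close>
    show "csqrt (1 + (q\<^sup>2 - 1)) = q" if "q \<in> ball 1 (sqrt 2 - 1)" for q
      using re[OF that] by (simp add: csqrt_square)
  qed (use \<rho> in \<open>auto intro!: holomorphic_intros\<close>)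
  then have "is_sharp_radius K3 S_L \<rho>"
    unfolding S_L_def
  proof (rule sharp_S_star_upper[OF _ \<rho>])
    fix w assume w: "cmod w < 1"
    show "csqrt (1 + w) \<noteq> of_real ((1 + \<rho>) / (1 - \<rho>))"
    proof
      assume "csqrt (1 + w) = of_real ((1 + \<rho>) / (1 - \<rho>))"
      then have "(csqrt (1 + w))\<^sup>2 = of_real ((sqrt 2)\<^sup>2)" unfolding v of_real_power by simp
      then have "1 + w = 2" by simp
      then have "w = 1" by (simp add: algebra_simps)
      then show False using w by simp
    qed
  qed
  then show ?thesis by (simp add: \<rho>_def)
qed

section \<open>The cardioid\<close>

text \<open>Expanding the hypothesis gives
  \<open>|s|^4 < 4 Re (s\<^sup>2) \<le> (2 Re s)\<^sup>2\<close>. Its square root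
  \<open>|s|\<^sup>2 < 2 Re s\<close> is the conclusion squared.\<close>

lemma norm_diff_1_less_1:
  assumes "cmod (s\<^sup>2 - 2) < 2" "Re s > 0"
  shows "cmod (s - 1) < 1"
proof -
  define x y where "x = Re s" and "y = Im s"
  have "(cmod (s\<^sup>2 - 2))\<^sup>2 < 2\<^sup>2" using assms(1) by (intro power_strict_mono) auto
  then have "(x\<^sup>2 - y\<^sup>2 - 2)\<^sup>2 + (2 * x * y)\<^sup>2 < 4"
    unfolding cmod_power2 by (simp add: x_def y_def Re_power2 Im_power2)
  then have "(x\<^sup>2 + y\<^sup>2)\<^sup>2 < (2 * x)\<^sup>2 - 4 * y\<^sup>2"
    by (simp add: power2_eq_square algebra_simps)
  then have "(x\<^sup>2 + y\<^sup>2)\<^sup>2 < (2 * x)\<^sup>2" using zero_le_power2[of y] by linarith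
  then have "x\<^sup>2 + y\<^sup>2 < 2 * x"
    using assms(2) by (auto intro: power2_less_imp_less simp: x_def)
  then have "(cmod (s - 1))\<^sup>2 < 1"
    unfolding cmod_power2 by (simp add: x_def y_def power2_eq_square algebra_simps)
  then show ?thesis by (simp add: abs_square_less_1)
qed

lemma sharp_S_c:
  assumes \<rho>: "0 < \<rho>" "\<rho> < 1" "radius_poly (1 / 3) \<rho> = 0"
  shows "is_sharp_radius K3 S_c \<rho>"
proof -
  let ?B = "ball (of_real (5 / 3)) (5 / 3 - 1 / 3) :: complex set"
  have re: "Re ((3 * q - 1) / 2) > 0" if "q \<in> ?B" for q
    using ball_of_realD(2)[OF that] by simp
  have rs: "Re (csqrt ((3 * q - 1) / 2)) > 0" if "q \<in> ?B" for q
    by (rule Re_csqrt_pos[OF re[OF that]])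
  have "admissible_radius K3 S_c \<rho>"
    unfolding S_c_def
  \<comment> \<open>Completing the square turns the target function into
    \<open>1/3 + 2/3 (z + 1)\<^sup>2\<close>, which explains \<open>g\<close>. With
    \<open>s = z + 1\<close>, the disc about \<open>5/3\<close> of radius \<open>4/3\<close> becomes
    \<open>|s\<^sup>2 - 2| < 2\<close>.\<close>
  proof (rule admissible_S_star_lower[OF _ _ \<rho>, where a="5 / 3" and g="\<lambda>q. csqrt ((3 * q - 1) / 2) - 1"])
    show "(\<lambda>q. csqrt ((3 * q - 1) / 2) - 1) holomorphic_on ?B"
      using re by (intro holomorphic_intros Re_pos_notin_nonpos_Reals) auto
    show "cmod (csqrt ((3 * q - 1) / 2) - 1) < 1" if "q \<in> ?B" for q
    proof (rule norm_diff_1_less_1[OF _ rs[OF that]])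
      have "(csqrt ((3 * q - 1) / 2))\<^sup>2 - 2 = of_real (3 / 2) * (q - of_real (5 / 3))"
        by (simp add: field_simps)
      then have "cmod ((csqrt ((3 * q - 1) / 2))\<^sup>2 - 2) = 3 / 2 * cmod (q - of_real (5 / 3))"
          by (simp only: norm_mult norm_of_real)
      then show "cmod ((csqrt ((3 * q - 1) / 2))\<^sup>2 - 2) < 2"
        using ball_of_realD(1)[OF that] by simp
    qed
    show "1 + 4 / 3 * (csqrt ((3 * q - 1) / 2) - 1) + 2 / 3 * (csqrt ((3 * q - 1) / 2) - 1)\<^sup>2 = q" for q
    proof -
      have "1 + 4 / 3 * (s - 1) + 2 / 3 * (s - 1)\<^sup>2 = 1 / 3 + 2 / 3 * s\<^sup>2" for s :: complex
        by (simp add: power2_eq_square field_simps)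
      then show ?thesis by (simp only: power2_csqrt) (simp add: field_simps)
    qed
  qed (auto intro!: holomorphic_intros)
  then show ?thesis
    unfolding S_c_def
  proof (rule sharp_S_star_lower[OF _ \<rho>])
    fix w :: complex assume w: "cmod w < 1"
    show "1 + 4 / 3 * w + 2 / 3 * w\<^sup>2 \<noteq> of_real (1 / 3)"
    proof
      assume "1 + 4 / 3 * w + 2 / 3 * w\<^sup>2 = of_real (1 / 3)"
      moreover have "1 + 4 / 3 * w + 2 / 3 * w\<^sup>2 = of_real (1 / 3) + 2 / 3 * (w + 1)\<^sup>2"
        by (simp add: power2_eq_square field_simps)
      ultimately have "2 / 3 * (w + 1)\<^sup>2 = 0" by (metis add_cancel_left_right)
      then have "w + 1 = 0" by simp
      then have "w = - 1" by (simp add: add_eq_0_iff2)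
      then show False using w by simp
    qed
  qed
qed

section \<open>The lune\<close>

lemma sharp_S_moon:
  assumes \<rho>: "0 < \<rho>" "\<rho> < 1" "radius_poly (sqrt 2 - 1) \<rho> = 0"
  shows "is_sharp_radius K3 S_moon \<rho>"
proof -
  let ?B = "ball (of_real (sqrt 2)) (sqrt 2 - (sqrt 2 - 1)) :: complex set"
  have s2: "sqrt 2 > 1.4" by (rule real_less_rsqrt) (simp add: power2_eq_square)
  have re: "Re q > 0" if "q \<in> ?B" for q
    using ball_of_realD(2)[OF that] s2 by simp
  have nz: "q \<noteq> 0" if "q \<in> ?B" for q using re[OF that] by auto
  have "admissible_radius K3 S_moon \<rho>"
    unfolding S_moon_def
  \<comment> \<open>Solving \<open>q = z + csqrt (1 + z\<^sup>2)\<close> for \<open>z\<close> gives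
    \<open>g\<close>. The disc has diameter from \<open>sqrt 2 - 1\<close> to
    \<open>sqrt 2 + 1\<close>, the two real boundary points of the lune.\<close>
  proof (rule admissible_S_star_lower[OF _ _ \<rho>, where a="sqrt 2" and g="\<lambda>q. (q - 1 / q) / 2"])
    show "(\<lambda>q. (q - 1 / q) / 2) holomorphic_on ?B"
      using nz by (intro holomorphic_intros) auto
    show "(\<lambda>z. z + csqrt (1 + z\<^sup>2)) holomorphic_on ball 0 1"
    proof (intro holomorphic_intros Re_pos_notin_nonpos_Reals)
      show "0 < Re (1 + z\<^sup>2)" if "z \<in> ball 0 1" for z
      proof -
        have "cmod (z\<^sup>2) < 1" using that by (simp add: norm_power power_less_one_iff)
        then show ?thesis using abs_Re_le_cmod[of "z\<^sup>2"] by (simp del: power2_eq_square Re_power2)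
      qed
    qed
    show "cmod ((q - 1 / q) / 2) < 1" if q: "q \<in> ?B" for q
    proof -
      define x y where "x = Re q" and "y = Im q"
      have "(cmod (q - of_real (sqrt 2)))\<^sup>2 < 1"
        using ball_of_realD(1)[OF q] by (simp add: abs_square_less_1)
      then have d: "(x - sqrt 2)\<^sup>2 + y\<^sup>2 < 1" unfolding cmod_power2 by (simp add: x_def y_def)
      have x: "sqrt 2 - 1 < x" using ball_of_realD(2)[OF q] by (simp add: x_def)
      have "\<bar>x - sqrt 2\<bar> < 1"
        using d zero_le_power2[of y] by (intro abs_square_less_1[THEN iffD1]) linarith
      then have x': "x < sqrt 2 + 1" by linarith
      have e: "x\<^sup>2 + y\<^sup>2 < 2 * sqrt 2 * x - 1" using d by (simp add: power2_eq_square algebra_simps)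
      have m: "(sqrt 2 - 1) * x < (sqrt 2 - 1) * (sqrt 2 + 1)"
        using x' s2 by (intro mult_strict_left_mono) auto
      \<comment> \<open>In the right half-plane \<open>|q\<^sup>2 - 1| < 2 |q|\<close> means inside
        the circle about 1 and outside the circle about -1, both of radius \<open>sqrt 2\<close>.
        These two conditions are \<open>up\<close> and \<open>lo\<close>.\<close>
      have up: "x\<^sup>2 + y\<^sup>2 - 1 < 2 * x"
        using e m by (simp add: algebra_simps)
      have lo: "1 - (x\<^sup>2 + y\<^sup>2) < 2 * x"
      proof -
        have "(sqrt 2 - 1 + 1)\<^sup>2 < (x + 1)\<^sup>2" using x s2 by (intro power_strict_mono) auto
        then have "2 < x\<^sup>2 + 2 * x + 1" by (simp add: power2_eq_square algebra_simps)
        then show ?thesis using zero_le_power2[of y] by linarith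
      qed
      have x0: "0 < x" using re[OF q] by (simp add: x_def)
      have "(x\<^sup>2 + y\<^sup>2 - 1)\<^sup>2 < (2 * x)\<^sup>2"
        by (rule power2_strict_mono) (use up lo x0 in linarith)
      then have "(cmod (q\<^sup>2 - 1))\<^sup>2 < (2 * cmod q)\<^sup>2"
        unfolding power_mult_distrib cmod_power2 by (simp add: x_def y_def power2_eq_square algebra_simps)
      then have "cmod (q\<^sup>2 - 1) < 2 * cmod q" by (rule power2_less_imp_less) simp
      moreover have "(q - 1 / q) / 2 = (q\<^sup>2 - 1) / (2 * q)"
        using nz[OF q] by (simp add: field_simps power2_eq_square)
      then have "cmod ((q - 1 / q) / 2) = cmod (q\<^sup>2 - 1) / (2 * cmod q)"
        by (simp only: norm_divide norm_mult norm_numeral)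
      ultimately show ?thesis using nz[OF q] by simp
    qed
    show "(q - 1 / q) / 2 + csqrt (1 + ((q - 1 / q) / 2)\<^sup>2) = q" if q: "q \<in> ?B" for q
    proof -
      have "csqrt (1 + ((q - 1 / q) / 2)\<^sup>2) = (q + 1 / q) / 2"
      proof (rule csqrt_unique)
        show "((q + 1 / q) / 2)\<^sup>2 = 1 + ((q - 1 / q) / 2)\<^sup>2"
          using nz[OF q] by (simp add: field_simps power2_eq_square)
        have "Re (1 / q) \<ge> 0" using re[OF q] by (simp add: Re_divide)
        then show "0 < Re ((q + 1 / q) / 2) \<or> Re ((q + 1 / q) / 2) = 0 \<and> 0 \<le> Im ((q + 1 / q) / 2)"
          using re[OF q] by simp
      qed
      then show ?thesis by (simp add: field_simps)
    qed
  qed (use s2 sqrt2_less_2 in auto)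
  then show ?thesis
    unfolding S_moon_def
  proof (rule sharp_S_star_lower[OF _ \<rho>])
    fix w :: complex assume w: "cmod w < 1"
    define t where "t = complex_of_real (sqrt 2 - 1)"
    have "sqrt 2 - 1 \<noteq> (0::real)" using s2 by linarith
    then have t0: "t \<noteq> 0" unfolding t_def of_real_eq_0_iff .
    \<comment> \<open>The value at \<open>w = -1\<close> is \<open>t\<close>, and this quadratic
      relation for \<open>t\<close> leaves \<open>w = -1\<close> as the only candidate after
      squaring.\<close>
    have "(sqrt 2 - 1)\<^sup>2 = 1 - 2 * (sqrt 2 - 1)" by (simp add: power2_eq_square algebra_simps)
    then have "complex_of_real ((sqrt 2 - 1)\<^sup>2) = of_real (1 - 2 * (sqrt 2 - 1))" by (rule arg_cong)
    then have t2: "t\<^sup>2 = 1 - 2 * t"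
      unfolding t_def by (simp only: of_real_power of_real_diff of_real_mult of_real_1 of_real_numeral)
    show "w + csqrt (1 + w\<^sup>2) \<noteq> of_real (sqrt 2 - 1)"
    proof
      assume "w + csqrt (1 + w\<^sup>2) = of_real (sqrt 2 - 1)"
      then have "csqrt (1 + w\<^sup>2) = t - w" by (simp add: t_def algebra_simps)
      then have "1 + w\<^sup>2 = (t - w)\<^sup>2" by (metis power2_csqrt)
      then have "1 = t\<^sup>2 - 2 * t * w" by (simp add: power2_eq_square algebra_simps)
      then have "2 * (t * (1 + w)) = 0" unfolding t2 by (simp add: algebra_simps)
      then have "w = - 1" using t0 by (simp add: add_eq_0_iff)
      then show False using w by simp
    qed
  qed
qed

section \<open>The exponential function\<close>

text \<open>With \<open>x + i y\<close> on the unit circle this says \<open>|exp (x + i y) - 3/e| \<ge> 2/e\<close>: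
  the image of the circle under \<open>exp\<close> avoids the disc with centre \<open>3/e\<close> through \<open>1/e\<close>.\<close>

lemma exp_circle_ineq:
  fixes x y :: real
  assumes xy: "x\<^sup>2 + y\<^sup>2 = 1"
  shows "(exp (1 + x))\<^sup>2 - 6 * exp (1 + x) * cos y + 5 \<ge> 0"
proof -
  define v u where "v = 1 + x" and "u = exp v"
  have "x\<^sup>2 \<le> 1" "y\<^sup>2 \<le> 1" using xy zero_le_power2[of x] zero_le_power2[of y] by linarith+
  then have x1: "\<bar>x\<bar> \<le> 1" "\<bar>y\<bar> \<le> 1" by (simp_all add: abs_square_le_1)
  then have v: "0 \<le> v" "v \<le> 2" by (auto simp: v_def)
  have y2: "y\<^sup>2 = v * (2 - v)" using xy by (simp add: v_def power2_eq_square algebra_simps)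
  have u1: "1 \<le> u" using v by (simp add: u_def)
  \<comment> \<open>This rearranges the claim via
    \<open>u\<^sup>2 - 6 u + 5 = (u - 1) (u - 5)\<close>; only \<open>u \<le> 5\<close> carries
    content. There, \<open>u - 1 \<le> u v\<close> and the quadratic bound for the cosine reduce it
    to the linear bound \<open>5 - u \<le> 11/4 (2 - v)\<close>.\<close>
  have "(u - 1) * (5 - u) \<le> 6 * u * (1 - cos y)"
  proof (cases "u \<le> 5")
    case True
    \<comment> \<open>The constant is \<open>1/2 - 1/24\<close>, from the Taylor expansion to fourth
      order and \<open>y ^ 4 \<le> y\<^sup>2\<close>.\<close>
    have cosy: "1 - cos y \<ge> 11 / 24 * y\<^sup>2"
    proof -
      obtain t where "cos y = (\<Sum>m<4. cos_coeff m * y ^ m) + cos (t + 1 / 2 * real 4 * pi) / fact 4 * y ^ 4"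
        using Maclaurin_cos_expansion[of y 4] by blast
      moreover have "cos (t + 1 / 2 * real 4 * pi) / fact 4 * y ^ 4 \<le> 1 / fact 4 * y ^ 4"
        by (intro mult_right_mono divide_right_mono) auto
      moreover have "(\<Sum>m<4. cos_coeff m * y ^ m) = 1 - y\<^sup>2 / 2"
        by (simp add: sin_coeff_Suc cos_coeff_Suc eval_nat_numeral)
      moreover have "y ^ 4 \<le> y\<^sup>2"
      proof -
        have "y\<^sup>2 * y\<^sup>2 \<le> y\<^sup>2 * 1" using x1 by (intro mult_left_mono) (auto simp: abs_square_le_1)
        then show ?thesis by (simp add: power2_eq_square power4_eq_xxxx)
      qed
      ultimately show ?thesis by (simp add: fact_numeral)
    qed
    have "1 + (- v) \<le> exp (- v)" by (rule exp_ge_add_one_self)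
    then have "(1 - v) * u \<le> exp (- v) * u" using u1 by (intro mult_right_mono) auto
    then have a: "u - 1 \<le> u * v" by (simp add: u_def algebra_simps flip: exp_add)
    have "1 + v / 2 + (v / 2)\<^sup>2 / 2 \<le> exp (v / 2)"
      using exp_lower_Taylor_quadratic[of "v / 2"] v by simp
    then have "(1 + v / 2 + (v / 2)\<^sup>2 / 2)\<^sup>2 \<le> (exp (v / 2))\<^sup>2" using v by (intro power_mono) auto
    also have "(exp (v / 2))\<^sup>2 = u" by (simp add: u_def power2_eq_square flip: exp_add)
    finally have "1 + v + v\<^sup>2 / 2 + v ^ 3 / 8 + v ^ 4 / 64 \<le> u"
      by (simp add: power2_eq_square power3_eq_cube power4_eq_xxxx algebra_simps)
    moreover have "0 \<le> v ^ 4 / 64" by simp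
    ultimately have b: "5 - u \<le> 4 - v - v\<^sup>2 / 2 - v ^ 3 / 8" by linarith
    \<comment> \<open>The cubic is bounded by a quadratic touching it at 1, and the resulting square
      by its tangent at \<open>5/4\<close>. That tangent point gives the linear bound the slope
      \<open>-11/4\<close> required.\<close>
    have "0 \<le> v * (v - 1)\<^sup>2 / 8" using v by simp
    then have "v ^ 3 / 8 \<ge> v\<^sup>2 / 4 - v / 8" by (simp add: power2_eq_square power3_eq_cube algebra_simps)
    moreover have "15 / 8 * v - 75 / 64 \<le> 3 / 4 * v\<^sup>2"
      using zero_le_power2[of "v - 5 / 4"] by (simp add: power2_eq_square field_simps)
    ultimately have "5 - u \<le> 11 / 2 - 11 / 4 * v" using b by linarith
    then have c: "5 - u \<le> 11 / 4 * (2 - v)" by (simp add: right_diff_distrib)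
    have "(u - 1) * (5 - u) \<le> (u * v) * (5 - u)" using a True by (intro mult_right_mono) auto
    also have "\<dots> \<le> (u * v) * (11 / 4 * (2 - v))" using c u1 v by (intro mult_left_mono) auto
    also have "\<dots> = 6 * u * (11 / 24 * y\<^sup>2)" unfolding y2 by (simp add: field_simps)
    also have "\<dots> \<le> 6 * u * (1 - cos y)" using cosy u1 by (intro mult_left_mono) auto
    finally show ?thesis .
  next
    case False
    then have "(u - 1) * (5 - u) \<le> 0" using u1 by (intro mult_nonneg_nonpos) auto
    also have "0 \<le> 6 * u * (1 - cos y)" using u1 by simp
    finally show ?thesis .
  qed
  then show ?thesis unfolding u_def v_def by (simp add: power2_eq_square algebra_simps)
qed

lemma exp_minus_1_bounds:
  "0.3678794 < exp (- 1 :: real)" "exp (- 1 :: real) < 0.3678795"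
proof -
  have "2.7182818 < exp (1::real)" "exp (1::real) < 2.7182819"
    using e_approx_32 unfolding abs_le_iff by simp_all
  then show "0.3678794 < exp (- 1 :: real)" "exp (- 1 :: real) < 0.3678795"
    unfolding exp_minus inverse_eq_divide by (simp_all add: field_simps)
qed

lemma sharp_S_e:
  assumes \<rho>: "0 < \<rho>" "\<rho> < 1" "radius_poly (exp (- 1)) \<rho> = 0"
  shows "is_sharp_radius K3 S_e \<rho>"
proof -
  define c where "c = exp (- 1 :: real)"
  \<comment> \<open>The centre \<open>3 * c\<close> is about \<open>1.1036\<close>, just above the
    threshold \<open>11/10\<close> of \<open>admissible_S_star_lower\<close>.\<close>
  have c: "1 / 3 \<le> c" "c < 0.37" "0 < c" "11 / 10 \<le> 3 * c" using exp_minus_1_bounds by (simp_all add: c_def)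
  let ?B = "ball (of_real (3 * c)) (3 * c - c) :: complex set"
  have re: "Re q > 0" if "q \<in> ?B" for q
    using ball_of_realD(2)[OF that] c by simp
  then have nz: "q \<noteq> 0" if "q \<in> ?B" for q using that by force
  have holLn: "Ln holomorphic_on ?B"
    using re Re_pos_notin_nonpos_Reals by (intro holomorphic_on_Ln) auto
  have "3 * c - 1 < 2 * c" using c by simp
  then have B1: "1 \<in> ?B" using c norm_of_real[where 'a=complex, of "3 * c - 1"]
    by (simp add: dist_norm norm_minus_commute)
  have "cmod (Ln q) \<noteq> 1" if q: "q \<in> ?B" for q
  proof
    assume l: "cmod (Ln q) = 1"
    define x y where "x = Re (Ln q)" and "y = Im (Ln q)"
    have xy: "x\<^sup>2 + y\<^sup>2 = 1" using l cmod_power2[of "Ln q"] by (simp add: x_def y_def)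
    have q': "Re q = exp x * cos y" "Im q = exp x * sin y"
      using exp_Ln[OF nz[OF q]] Re_exp[of "Ln q"] Im_exp[of "Ln q"] by (simp_all add: x_def y_def)
    \<comment> \<open>This extracts the common factor of \<open>exp x\<close> and the centre, so
      that membership in the disc becomes the negation of \<open>exp_circle_ineq\<close> times
      \<open>c\<^sup>2\<close>.\<close>
    have u: "exp x = exp (1 + x) * c" by (simp add: c_def flip: exp_add)
    have "(cmod (q - of_real (3 * c)))\<^sup>2 < (2 * c)\<^sup>2"
      using ball_of_realD(1)[OF q] c by (intro power_strict_mono) auto
    then have "(exp x * cos y - 3 * c)\<^sup>2 + (exp x * sin y)\<^sup>2 < (2 * c)\<^sup>2"
      unfolding cmod_power2 by (simp add: q')
    moreover have "(exp x * sin y)\<^sup>2 = (exp x)\<^sup>2 - (exp x * cos y)\<^sup>2"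
      by (simp add: power_mult_distrib sin_squared_eq algebra_simps)
    ultimately have "c\<^sup>2 * ((exp (1 + x))\<^sup>2 - 6 * exp (1 + x) * cos y + 5) < 0"
      unfolding u by (simp add: power2_eq_square algebra_simps)
    moreover have "0 \<le> c\<^sup>2 * ((exp (1 + x))\<^sup>2 - 6 * exp (1 + x) * cos y + 5)"
      using exp_circle_ineq[OF xy] by simp
    ultimately show False by linarith
  qed
  then have Ln1: "cmod (Ln q) < 1" if "q \<in> ?B" for q
    using connected_norm_less_1[of ?B Ln 1 q] holomorphic_on_imp_continuous_on[OF holLn] B1 that by auto
  have "admissible_radius K3 S_e \<rho>"
    unfolding S_e_def
    by (rule admissible_S_star_lower[of c \<rho> "3 * c" _ Ln])
       (use c \<rho> holLn Ln1 nz in \<open>auto simp flip: c_def intro!: holomorphic_intros\<close>)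
  then show ?thesis
    unfolding S_e_def
  proof (rule sharp_S_star_lower[OF _ \<rho>])
    fix w :: complex assume w: "cmod w < 1"
    show "exp w \<noteq> of_real (exp (- 1))"
    proof
      assume "exp w = of_real (exp (- 1))"
      then have "cmod (exp w) = exp (- 1)" by (simp only: norm_of_real) simp
      then have "Re w = - 1" by simp
      then show False using w abs_Re_le_cmod[of w] by simp
    qed
  qed
qed

section \<open>The sine function\<close>

text \<open>With \<open>z = x + i y\<close>, \<open>|sin z|\<^sup>2 = (sin x)\<^sup>2 + (sinh
  y)\<^sup>2 \<ge> (sin x)\<^sup>2 + y\<^sup>2 = 1 - (x\<^sup>2 - (sin x)\<^sup>2)\<close>. The last
  difference factors into two terms increasing in \<open>|x|\<close>, so it is largest at
  \<open>|x| = 1\<close>.\<close>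

lemma sin_1_le_norm_sin:
  assumes z: "cmod z = 1"
  shows "sin 1 \<le> cmod (sin z)"
proof -
  define x y where "x = Re z" and "y = Im z"
  have xy: "x\<^sup>2 + y\<^sup>2 = 1" using z cmod_power2[of z] by (simp add: x_def y_def)
  have "x\<^sup>2 \<le> 1" using xy zero_le_power2[of y] by linarith
  then have x1: "\<bar>x\<bar> \<le> 1" by (simp add: abs_square_le_1)
  define t where "t = \<bar>x\<bar>"
  have t: "0 \<le> t" "t \<le> 1" using x1 by (auto simp: t_def)
  have mono: "t - sin t \<le> 1 - sin 1"
    by (rule DERIV_nonneg_imp_nondecreasing[OF t(2), of "\<lambda>t. t - sin t"])
       (auto intro!: exI derivative_eq_intros)
  have s: "0 \<le> t - sin t" "0 \<le> sin t" "sin t \<le> sin 1"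
    using sin_x_le_x[OF t(1)] sin_ge_zero[of t] t pi_gt3 sin_monotone_2pi_le[of t 1] by auto
  have "(t - sin t) * (t + sin t) \<le> (1 - sin 1) * (1 + sin 1)"
    using mono s t by (intro mult_mono) auto
  then have a: "t\<^sup>2 - (sin t)\<^sup>2 \<le> 1 - (sin 1)\<^sup>2" by (simp add: power2_eq_square algebra_simps)
  have sx: "(sin t)\<^sup>2 = (sin x)\<^sup>2" "t\<^sup>2 = x\<^sup>2" by (auto simp: t_def abs_if)
  have "\<bar>y\<bar> \<le> \<bar>(exp y - inverse (exp y)) / 2\<bar>" by (rule real_le_abs_sinh)
  then have "y\<^sup>2 \<le> ((exp y - inverse (exp y)) / 2)\<^sup>2" by (simp only: abs_le_square_iff)
  moreover have "(cmod (sin z))\<^sup>2 = (sin x)\<^sup>2 + ((exp y - inverse (exp y)) / 2)\<^sup>2"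
    unfolding norm_sin_squared x_def y_def cos_double_sin exp_double
    by (simp add: power2_eq_square field_simps)
  ultimately have "(sin 1)\<^sup>2 \<le> (cmod (sin z))\<^sup>2" using a sx xy by linarith
  then show ?thesis by (rule power2_le_imp_le) simp
qed

lemma sin_1_bounds: "0.84147 < sin (1::real)" "sin (1::real) < 0.841472"
proof -
  have "\<bar>sin 1 - (\<Sum>m<11. sin_coeff m * (1::real) ^ m)\<bar> \<le> inverse (fact 11) * \<bar>1\<bar> ^ 11"
    by (rule Maclaurin_sin_bound)
  then show "0.84147 < sin (1::real)" "sin (1::real) < 0.841472"
    unfolding abs_le_iff
    by (simp_all add: sin_coeff_Suc cos_coeff_Suc eval_nat_numeral)
qed

lemma sharp_S_sin: "is_sharp_radius K3 S_sin (sin 1 / (2 + sin 1))"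
proof -
  define s where "s = sin (1::real)"
  define \<rho> where "\<rho> = s / (2 + s)"
  have s: "0 < s" "s < 1" using sin_1_bounds by (simp_all add: s_def)
  have \<rho>: "0 < \<rho>" "\<rho> < 1" using s by (simp_all add: \<rho>_def divide_simps)
  have v: "(1 + \<rho>) / (1 - \<rho>) = 1 + s" "2 * \<rho> / (1 - \<rho>) = s"
    using s by (simp_all add: \<rho>_def divide_simps)
  let ?B = "ball 1 s :: complex set"
  have B: "cmod (q - 1) < s" if "q \<in> ?B" for q using that by (simp add: dist_norm norm_minus_commute)
  have hol: "(\<lambda>q. Arcsin (q - 1)) holomorphic_on ?B"
  proof -
    have "Arcsin holomorphic_on ball 0 1"
    proof (rule holomorphic_on_Arcsin)
      show "\<bar>Re z\<bar> < 1" if "z \<in> ball 0 1" for z using that abs_Re_le_cmod[of z] by simp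
    qed
    then show ?thesis
      using holomorphic_on_compose_gen[of "\<lambda>q. q - 1" ?B Arcsin "ball 0 1"] B s
      by (force simp: o_def image_subset_iff intro!: holomorphic_intros)
  qed
  have "cmod (Arcsin (q - 1)) \<noteq> 1" if "q \<in> ?B" for q
    using sin_1_le_norm_sin[of "Arcsin (q - 1)"] B[OF that] by (auto simp: s_def)
  then have less1: "cmod (Arcsin (q - 1)) < 1" if "q \<in> ?B" for q
    using connected_norm_less_1[of ?B "\<lambda>q. Arcsin (q - 1)" 1 q] that s
      holomorphic_on_imp_continuous_on[OF hol] by auto
  have "admissible_radius K3 S_sin \<rho>"
    unfolding S_sin_def
  proof (rule admissible_S_star[OF \<rho>(2) _ _ hol])
    show "log_quot f z \<in> ball 1 s" if "f \<in> K3" "cmod z < \<rho>" for f z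
      using log_quot_K3_near_1[OF that \<rho>(2)] v by (simp add: dist_norm norm_minus_commute)
  qed (use less1 in \<open>auto intro!: holomorphic_intros\<close>)
  then have "is_sharp_radius K3 S_sin \<rho>"
    unfolding S_sin_def
  proof (rule sharp_S_star_upper[OF _ \<rho>])
    fix w :: complex assume w: "cmod w < 1"
    \<comment> \<open>The closed unit disc lies in the strip \<open>|Re z| < pi/2\<close>, where the
      sine is injective; so the value \<open>sin 1\<close> is taken at 1 only.\<close>
    have Asin: "Arcsin (sin z) = z" if "cmod z \<le> 1" for z
      using that abs_Re_le_cmod[of z] pi_gt3 by (intro Arcsin_sin) linarith
    show "1 + sin w \<noteq> of_real ((1 + \<rho>) / (1 - \<rho>))"
    proof
      assume "1 + sin w = of_real ((1 + \<rho>) / (1 - \<rho>))"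
      then have "sin w = sin 1" unfolding v by (simp add: s_def flip: sin_of_real)
      then have "w = 1" using Asin[of w] Asin[of 1] w by simp
      then show False using w by simp
    qed
  qed
  then show ?thesis by (simp add: \<rho>_def s_def)
qed

section \<open>The rational function \<open>h_R\<close>\<close>

lemma sqrt2_bounds: "1.41421356 < sqrt (2::real)" "sqrt (2::real) < 1.41421357"
  by (rule real_less_rsqrt real_less_lsqrt; simp add: power2_eq_square)+

text \<open>The critical value \<open>c = h_R (-1)\<close> turns \<open>h_R z - c\<close> into \<open>(1 + z)\<^sup>2 / (k (k - z))\<close>.\<close>

lemma h_R_eq:
  assumes "z \<noteq> of_real (sqrt 2 + 1)"
  shows "h_R z = of_real (2 * sqrt 2 - 2) + (1 + z)\<^sup>2 / (of_real (sqrt 2 + 1) * (of_real (sqrt 2 + 1) - z))"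
proof -
  define k where "k = complex_of_real (sqrt 2 + 1)"
  have s2: "complex_of_real (sqrt 2) * complex_of_real (sqrt 2) = 2"
    by (simp flip: of_real_mult)
  have k2: "k * k = 2 * k + 1" and kc: "of_real (2 * sqrt 2 - 2) = 2 * k - 4"
    using s2 by (simp_all add: k_def algebra_simps)
  have kz: "k - z \<noteq> 0" using assms by (simp add: k_def)
  have k0: "k \<noteq> 0" using k2 by auto
  have "h_R z - (2 * k - 4) = (1 + z)\<^sup>2 / (k * (k - z))"
  proof -
    have "k\<^sup>2 - k * z = k * (k - z)" by (simp add: power2_eq_square algebra_simps)
    moreover have "1 - (2 * k - 4) + (k * z + z\<^sup>2) / (k * (k - z))
       = ((1 - (2 * k - 4)) * (k * (k - z)) + (k * z + z\<^sup>2)) / (k * (k - z))"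
      using kz k0 by (simp add: add_divide_distrib)
    moreover have "(1 - (2 * k - 4)) * (k * (k - z)) + (k * z + z\<^sup>2) = (1 + z)\<^sup>2"
    proof -
      have "(1 - (2 * k - 4)) * (k * (k - z)) = 5 * (k * k) - 2 * (k * k) * k - 5 * (k * z) + 2 * (k * k) * z"
        by (simp add: algebra_simps)
      also have "\<dots> = 1 + (2 - k) * z"
        using k2 by algebra
      finally show ?thesis by (simp add: power2_eq_square algebra_simps)
    qed
    moreover have "h_R z - (2 * k - 4) = 1 - (2 * k - 4) + (k * z + z\<^sup>2) / (k\<^sup>2 - k * z)"
      unfolding h_R_def Let_def k_def[symmetric] by simp
    ultimately show ?thesis by (simp only:)
  qed
  then show ?thesis unfolding kc k_def[symmetric] by (simp add: algebra_simps)
qed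

text \<open>The disc about \<open>sqrt 2\<close> has diameter from
  \<open>h_R (-1) = 2 sqrt 2 - 2\<close> to \<open>h_R 1 = 2\<close>. After clearing denominators
  the squares of the two sides differ by a positive multiple of \<open>(Im z)\<^sup>2\<close>, so
  the circle is met at those two points only.\<close>

lemma h_R_circle:
  assumes z: "cmod z = 1"
  shows "2 - sqrt 2 \<le> cmod (h_R z - of_real (sqrt 2))"
proof -
  define s where "s = sqrt (2::real)"
  define x y where "x = Re z" and "y = Im z"
  have s: "1 < s" "s * s = 2" by (simp_all add: s_def)
  have xy: "x\<^sup>2 + y\<^sup>2 = 1" using z cmod_power2[of z] by (simp add: x_def y_def)
  define k where "k = complex_of_real (s + 1)"
  have ck: "cmod k = s + 1" unfolding k_def norm_of_real using s by simp
  have kz: "k \<noteq> z" using ck z s by auto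
  have k0: "k \<noteq> 0" using ck s by auto
  have bk: "(2 - s) * (s + 1) = s" using s by (simp add: algebra_simps)
  have bk': "of_real (2 - s) * k = of_real s" unfolding k_def of_real_mult[symmetric] bk ..
  have "h_R z - of_real s = (1 + z)\<^sup>2 / (k * (k - z)) - of_real (2 - s)"
    using h_R_eq[of z] kz by (simp add: k_def s_def algebra_simps)
  also have "\<dots> = ((1 + z)\<^sup>2 - of_real s * (k - z)) / (k * (k - z))"
    unfolding bk'[symmetric] using kz k0 by (simp add: diff_divide_distrib)
  finally have e: "cmod (h_R z - of_real s) = cmod ((1 + z)\<^sup>2 - of_real s * (k - z)) / ((s + 1) * cmod (k - z))"
    by (simp only: norm_divide norm_mult ck)
  have "(cmod ((1 + z)\<^sup>2 - of_real s * (k - z)))\<^sup>2 - (s * cmod (k - z))\<^sup>2 = 4 * (1 + s) * y\<^sup>2"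
  proof -
    have R: "Re ((1 + z)\<^sup>2 - of_real s * (k - z)) = (1 + x)\<^sup>2 - y\<^sup>2 - s * (s + 1 - x)"
      and I: "Im ((1 + z)\<^sup>2 - of_real s * (k - z)) = 2 * (1 + x) * y + s * y"
      by (simp_all add: x_def y_def k_def Re_power2 Im_power2)
    have "((1 + x)\<^sup>2 - y\<^sup>2 - s * (s + 1 - x))\<^sup>2 + (2 * (1 + x) * y + s * y)\<^sup>2 - s\<^sup>2 * ((s + 1 - x)\<^sup>2 + y\<^sup>2)
        = 4 * (1 + s) * y\<^sup>2"
      using xy s(2) by algebra
    then show ?thesis
      unfolding power_mult_distrib cmod_power2 R I by (simp add: x_def y_def k_def)
  qed
  moreover have "0 \<le> 4 * (1 + s) * y\<^sup>2" using s by simp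
  ultimately have "(s * cmod (k - z))\<^sup>2 \<le> (cmod ((1 + z)\<^sup>2 - of_real s * (k - z)))\<^sup>2" by linarith
  then have le: "s * cmod (k - z) \<le> cmod ((1 + z)\<^sup>2 - of_real s * (k - z))"
    by (rule power2_le_imp_le) simp
  have "2 - s = s / (s + 1)"
    using bk s by (simp add: field_simps)
  also have "\<dots> = s * cmod (k - z) / ((s + 1) * cmod (k - z))"
    using kz by simp
  also have "\<dots> \<le> cmod (h_R z - of_real s)"
    unfolding e using le s by (intro divide_right_mono) auto
  finally show ?thesis by (simp add: s_def)
qed

lemma sharp_S_R:
  assumes \<rho>: "0 < \<rho>" "\<rho> < 1" "radius_poly (2 * sqrt 2 - 2) \<rho> = 0"
  shows "is_sharp_radius K3 S_R \<rho>"
proof -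
  define k where "k = complex_of_real (sqrt 2 + 1)"
  define c where "c = 2 * sqrt 2 - 2"
  define d where "d = complex_of_real (2 * sqrt 2 + 2)"
  let ?B = "ball (of_real (sqrt 2)) (sqrt 2 - (2 * sqrt 2 - 2)) :: complex set"
  \<comment> \<open>Up to the factor \<open>k\<close>, \<open>S\<close> is the square root of the
    discriminant of the quadratic equation for \<open>z\<close> in \<open>h_R z = q\<close>. The
    discriminant \<open>q\<^sup>2 + 4 q - 4\<close> is split at its roots so that each factor stays
    in the right half-plane on the disc and the principal roots are holomorphic.\<close>
  define S where "S = (\<lambda>q. csqrt (q - of_real c) * csqrt (q + d))"
  define g where "g = (\<lambda>q. k / 2 * (S q - q))"
  have S2: "(S q)\<^sup>2 = q\<^sup>2 + 4 * q - 4" for q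
  proof -
    have "of_real c * d = 4" "of_real c - d = - 4"
      unfolding c_def d_def of_real_mult[symmetric] of_real_diff[symmetric] by (simp_all add: algebra_simps)
    moreover have "(S q)\<^sup>2 = q\<^sup>2 - (of_real c - d) * q - of_real c * d"
      unfolding S_def power_mult_distrib power2_csqrt by (simp add: power2_eq_square algebra_simps)
    ultimately show ?thesis by simp
  qed
  have gq: "(g q)\<^sup>2 + k * q * g q - (q - 1) * k\<^sup>2 = 0" for q
  proof -
    have "(g q)\<^sup>2 + k * q * g q - (q - 1) * k\<^sup>2 = k\<^sup>2 / 4 * ((S q)\<^sup>2 - (q\<^sup>2 + 4 * q - 4))"
      unfolding g_def by (simp add: power2_eq_square field_simps)
    then show ?thesis by (simp add: S2)
  qed
  have k0: "k \<noteq> 0" and ck: "cmod k > 1"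
  proof -
    have "cmod k = sqrt 2 + 1" unfolding k_def norm_of_real by simp
    then show "cmod k > 1" by simp
    then show "k \<noteq> 0" by auto
  qed
  \<comment> \<open>The point \<open>k\<close> is the pole of \<open>h_R\<close>; the quadratic
    equation excludes it, as it would force \<open>2 * k\<^sup>2 = 0\<close>.\<close>
  have gk: "g q \<noteq> k" for q
  proof
    assume "g q = k"
    then have "2 * k\<^sup>2 = 0" using gq[of q] by (simp add: power2_eq_square algebra_simps)
    then show False using k0 by simp
  qed
  have hg: "h_R (g q) = q" for q
  proof -
    have "k\<^sup>2 - k * g q \<noteq> 0" using gk[of q] k0 by (simp add: power2_eq_square)
    moreover have "k * g q + (g q)\<^sup>2 = (q - 1) * (k\<^sup>2 - k * g q)"
      using gq[of q] by (simp add: algebra_simps)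
    ultimately show ?thesis unfolding h_R_def Let_def k_def[symmetric] by simp
  qed
  have s2: "1.4 < sqrt 2" "sqrt 2 < 1.5" using sqrt2_bounds by simp_all
  have re: "Re (q - of_real c) > 0" "Re (q + d) > 0" if "q \<in> ?B" for q
    using ball_of_realD(2)[OF that] s2 by (simp_all add: c_def d_def)
  have hol: "g holomorphic_on ?B"
    unfolding g_def S_def
    using re by (intro holomorphic_intros Re_pos_notin_nonpos_Reals) auto
  have g1: "g 1 = 0"
  proof -
    have "csqrt (1 - of_real c) = of_real (sqrt 2 - 1)"
    proof (rule csqrt_unique)
      have "(sqrt 2 - 1)\<^sup>2 = 1 - c" by (simp add: c_def power2_eq_square algebra_simps)
      then show "(complex_of_real (sqrt 2 - 1))\<^sup>2 = 1 - of_real c"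
        by (metis of_real_power of_real_diff of_real_1)
    qed (use s2 in simp)
    moreover have "csqrt (1 + d) = of_real (sqrt 2 + 1)"
    proof (rule csqrt_unique)
      have "(sqrt 2 + 1)\<^sup>2 = 1 + (2 * sqrt 2 + 2)" by (simp add: power2_eq_square algebra_simps)
      then show "(complex_of_real (sqrt 2 + 1))\<^sup>2 = 1 + d"
        unfolding d_def by (metis of_real_power of_real_add of_real_1)
    qed (use s2 in simp)
    moreover have "complex_of_real (sqrt 2 - 1) * of_real (sqrt 2 + 1) = 1"
      unfolding of_real_mult[symmetric] by (simp add: algebra_simps)
    ultimately show ?thesis by (simp only: g_def S_def) simp
  qed
  have "cmod (g q) \<noteq> 1" if "q \<in> ?B" for q
    using h_R_circle[of "g q"] hg[of q] ball_of_realD(1)[OF that] by auto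
  moreover have "1 \<in> ?B"
    using norm_of_real[where 'a=complex, of "sqrt 2 - 1"] s2 by (simp add: dist_norm)
  ultimately have less1: "cmod (g q) < 1" if "q \<in> ?B" for q
    using connected_norm_less_1[of ?B g 1 q] that g1 holomorphic_on_imp_continuous_on[OF hol] by auto
  have hol_h: "h_R holomorphic_on ball 0 1"
  proof -
    have "k\<^sup>2 - k * z \<noteq> 0" if "z \<in> ball 0 1" for z
      using that k0 ck by (auto simp: power2_eq_square)
    then show ?thesis
      unfolding h_R_def Let_def k_def[symmetric] by (intro holomorphic_intros) auto
  qed
  have "admissible_radius K3 S_R \<rho>"
    unfolding S_R_def
    by (rule admissible_S_star_lower[OF _ _ \<rho> _ hol_h hol less1 hg g1]) (use s2 in simp_all)
  then show ?thesis
    unfolding S_R_def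
  proof (rule sharp_S_star_lower[OF _ \<rho>])
    fix w :: complex assume w: "cmod w < 1"
    have wk: "w \<noteq> k" using w ck by auto
    have "1 + w \<noteq> 0" using w by (metis add_eq_0_iff norm_minus_cancel norm_one order_less_irrefl)
    then have "(1 + w)\<^sup>2 / (k * (k - w)) \<noteq> 0" using wk k0 by simp
    then show "h_R w \<noteq> of_real (2 * sqrt 2 - 2)"
      using h_R_eq[of w] wk by (simp add: k_def)
  qed
qed

section \<open>The reverse lemniscate\<close>

text \<open>The conclusion is \<open>|s\<^sup>2 - 1| < 1\<close>, the inside of Bernoulli's
  lemniscate with both lobes. Outside it \<open>|s|\<^sup>2 + 1\<close> is at least
  \<open>sqrt (1 + 4 x\<^sup>2)\<close> for \<open>x = Re s\<close>; bounding this root below by a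
  linear function of \<open>x\<close> gives a lower bound for \<open>|s - A|\<close>.\<close>

lemma lemniscate_disc:
  fixes s :: complex
  assumes A: "A\<^sup>2 \<le> 1" and s: "(cmod (s - of_real A))\<^sup>2 < sqrt (1 - A\<^sup>2) - (1 - A\<^sup>2)"
  shows "(cmod (s\<^sup>2))\<^sup>2 < 2 * Re (s\<^sup>2)"
proof (rule ccontr)
  define x y w where "x = Re s" and "y = Im s" and "w = sqrt (1 - A\<^sup>2)"
  have w2: "w\<^sup>2 = 1 - A\<^sup>2" using A by (simp add: w_def)
  assume "\<not> (cmod (s\<^sup>2))\<^sup>2 < 2 * Re (s\<^sup>2)"
  moreover have "cmod (s\<^sup>2) = x\<^sup>2 + y\<^sup>2" by (simp add: norm_power cmod_power2 x_def y_def)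
  moreover have "Re (s\<^sup>2) = x\<^sup>2 - y\<^sup>2" by (simp add: x_def y_def Re_power2)
  ultimately have "2 * (x\<^sup>2 - y\<^sup>2) \<le> (x\<^sup>2 + y\<^sup>2)\<^sup>2" by simp
  then have "1 + 4 * x\<^sup>2 \<le> (x\<^sup>2 + y\<^sup>2 + 1)\<^sup>2" by (simp add: power2_eq_square algebra_simps)
  \<comment> \<open>Cauchy--Schwarz for \<open>(w, A)\<close> and \<open>(1, 2 x)\<close>, the first being a unit vector\<close>
  moreover have "(w + 2 * A * x)\<^sup>2 = 1 + 4 * x\<^sup>2 - (2 * w * x - A)\<^sup>2"
    using w2 by algebra
  moreover have "0 \<le> (2 * w * x - A)\<^sup>2" by simp
  ultimately have "(w + 2 * A * x)\<^sup>2 \<le> (x\<^sup>2 + y\<^sup>2 + 1)\<^sup>2" by linarith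
  then have "w + 2 * A * x \<le> x\<^sup>2 + y\<^sup>2 + 1" by (rule power2_le_imp_le) simp
  moreover have "(x - A)\<^sup>2 + y\<^sup>2 < w - (1 - A\<^sup>2)"
    using s unfolding cmod_power2 w_def by (simp add: x_def y_def)
  ultimately show False by (simp add: power2_eq_square algebra_simps)
qed

lemma admissible_S_RL: "admissible_radius K3 S_RL 0.125145"
proof -
  define r A :: real where "r = 0.125145" and "A = sqrt 2 - ctr r"
  define \<delta> where "\<delta> = sqrt 2 - 1"
  have r: "0 \<le> r" "r < 1" by (simp_all add: r_def)
  have A: "0.4137228 < A" "A < 0.41373"
    using sqrt2_bounds by (simp_all add: A_def ctr_def r_def power4_eq_xxxx)
  have A2: "A\<^sup>2 \<le> 1" using A by (simp add: abs_square_le_1)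
  have disc: "(rad r)\<^sup>2 \<le> sqrt (1 - A\<^sup>2) - (1 - A\<^sup>2)"
  proof -
    \<comment> \<open>The aim is \<open>(T + R)\<^sup>2 \<le> T\<close>. The difference
      \<open>T - (T + R)\<^sup>2\<close> decreases over the range in question, so checking the upper
      end \<open>T1\<close>, which comes from the lower bound for \<open>A\<close>, suffices.
      \<open>R\<close> is a decimal upper bound for the squared radius.\<close>
    define T T1 R :: real where "T = 1 - A\<^sup>2" and "T1 = 1 - 0.4137228\<^sup>2" and "R = 0.0815688"
    have "A\<^sup>2 < 0.41373\<^sup>2" "0.4137228\<^sup>2 < A\<^sup>2" using A by (intro power_strict_mono; simp)+
    then have T: "0.8 \<le> T" "T \<le> T1" by (simp_all add: T_def T1_def power2_eq_square)
    have R: "0 \<le> (rad r)\<^sup>2" "(rad r)\<^sup>2 \<le> R"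
      by (simp_all add: rad_def r_def R_def power2_eq_square power4_eq_xxxx)
    have "(T + (rad r)\<^sup>2)\<^sup>2 \<le> (T + R)\<^sup>2" using T R by (intro power_mono) auto
    also have "\<dots> = T - (T1 - (T1 + R)\<^sup>2) - (T1 - T) * (T1 + T + 2 * R - 1)"
      by (simp add: power2_eq_square algebra_simps)
    also have "\<dots> \<le> T"
    proof -
      have "0 \<le> (T1 - T) * (T1 + T + 2 * R - 1)" using T by (intro mult_nonneg_nonneg) (auto simp: R_def)
      moreover have "0 \<le> T1 - (T1 + R)\<^sup>2" by (simp add: T1_def R_def power2_eq_square)
      ultimately show ?thesis by linarith
    qed
    finally have "T + (rad r)\<^sup>2 \<le> sqrt T" by (rule real_le_rsqrt)
    then show ?thesis by (simp add: T_def)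
  qed
  have radA: "rad r < A" "0 \<le> rad r" using A by (simp_all add: rad_def r_def power2_eq_square power4_eq_xxxx)
  have \<delta>: "0 < \<delta>" "2 * \<delta> < 1" "\<delta>\<^sup>2 = 1 - 2 * \<delta>"
    using sqrt2_bounds by (simp_all add: \<delta>_def power2_eq_square algebra_simps)
  let ?B = "ball (of_real (ctr r)) (rad r) :: complex set"
  \<comment> \<open>Solving \<open>h_RL z = q\<close> first gives \<open>U q\<close> as the value of
    the square root; squaring leaves a Moebius equation for \<open>z\<close>, whose solution is
    \<open>g q\<close>.\<close>
  define U where "U = (\<lambda>q::complex. (of_real (sqrt 2) - q) / of_real \<delta>)"
  define g where "g = (\<lambda>q. (1 - (U q)\<^sup>2) / (1 + of_real (2 * \<delta>) * (U q)\<^sup>2))"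
  have \<delta>0: "complex_of_real \<delta> \<noteq> 0" using \<delta> by simp
  have lem: "(cmod ((of_real (sqrt 2) - q)\<^sup>2))\<^sup>2 < 2 * Re ((of_real (sqrt 2) - q)\<^sup>2)" if q: "q \<in> ?B" for q
  proof (rule lemniscate_disc[OF A2])
    have "cmod (of_real (sqrt 2) - q - of_real A) = cmod (q - of_real (ctr r))"
      by (simp add: A_def norm_minus_commute)
    also have "\<dots> < rad r" by (rule ball_of_realD(1)[OF q])
    finally have "(cmod (of_real (sqrt 2) - q - of_real A))\<^sup>2 < (rad r)\<^sup>2"
      by (intro power_strict_mono) auto
    with disc show "(cmod (of_real (sqrt 2) - q - of_real A))\<^sup>2 < sqrt (1 - A\<^sup>2) - (1 - A\<^sup>2)" by linarith
  qed
  \<comment> \<open>This selects one lobe, where \<open>U q\<close> is the principal root of its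
    square.\<close>
  have ReU: "Re (U q) > 0" if q: "q \<in> ?B" for q
  proof -
    have "Re q - ctr r < rad r"
      using ball_of_realD(1)[OF q] abs_Re_le_cmod[of "q - of_real (ctr r)"] by simp
    then have "Re q < sqrt 2" using radA by (simp add: A_def)
    then show ?thesis using \<delta> by (simp add: U_def)
  qed
  have V: "\<delta>\<^sup>2 * (cmod ((U q)\<^sup>2))\<^sup>2 < 2 * Re ((U q)\<^sup>2)" if q: "q \<in> ?B" for q
  proof -
    have "(of_real (sqrt 2) - q)\<^sup>2 = of_real (\<delta>\<^sup>2) * (U q)\<^sup>2"
      using \<delta>0 by (simp add: U_def power_divide)
    then have e: "cmod ((of_real (sqrt 2) - q)\<^sup>2) = \<delta>\<^sup>2 * cmod ((U q)\<^sup>2)"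
        "Re ((of_real (sqrt 2) - q)\<^sup>2) = \<delta>\<^sup>2 * Re ((U q)\<^sup>2)"
      by (simp_all only: norm_mult norm_of_real Re_complex_of_real Im_complex_of_real times_complex.sel) simp_all
    have "\<delta>\<^sup>2 * (\<delta>\<^sup>2 * (cmod ((U q)\<^sup>2))\<^sup>2) < \<delta>\<^sup>2 * (2 * Re ((U q)\<^sup>2))"
      using lem[OF q] unfolding e by (simp add: power2_eq_square algebra_simps)
    then show ?thesis using \<delta> by (simp add: mult_less_cancel_left_pos)
  qed
  have ReV: "Re ((U q)\<^sup>2) > 0" if q: "q \<in> ?B" for q
  proof -
    have "0 \<le> \<delta>\<^sup>2 * (cmod ((U q)\<^sup>2))\<^sup>2" by simp
    then show ?thesis using V[OF q] by linarith
  qed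
  have den: "1 + of_real (2 * \<delta>) * V \<noteq> 0" if "Re V > 0" for V
  proof -
    have "Re (1 + of_real (2 * \<delta>) * V) > 0" using that \<delta> by (simp add: add_pos_pos)
    then show ?thesis by (metis less_irrefl zero_complex.sel(1))
  qed
  have hol: "g holomorphic_on ?B"
    unfolding g_def U_def using den[OF ReV] \<delta>0 by (intro holomorphic_intros) (auto simp: U_def)
  have less1: "cmod (g q) < 1" if q: "q \<in> ?B" for q
  proof -
    define V where "V = (U q)\<^sup>2"
    \<comment> \<open>Because \<open>\<delta>\<^sup>2 = 1 - 2 * \<delta>\<close>, the second factor
      is precisely the lemniscate condition \<open>V\<close>; the factor
      \<open>1 + 2 * \<delta>\<close> is positive.\<close>
    have "(cmod (1 + of_real (2 * \<delta>) * V))\<^sup>2 - (cmod (1 - V))\<^sup>2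
        = (1 + 2 * \<delta>) * (2 * Re V - (1 - 2 * \<delta>) * (cmod V)\<^sup>2)"
      unfolding cmod_power2 by (simp add: power2_eq_square algebra_simps)
    also have "\<dots> > 0"
    proof (rule mult_pos_pos)
      show "0 < 2 * Re V - (1 - 2 * \<delta>) * (cmod V)\<^sup>2"
        using V[OF q] unfolding V_def[symmetric] \<delta>(3) by linarith
    qed (use \<delta> in linarith)
    finally have "(cmod (1 - V))\<^sup>2 < (cmod (1 + of_real (2 * \<delta>) * V))\<^sup>2" by linarith
    then have "cmod (1 - V) < cmod (1 + of_real (2 * \<delta>) * V)"
      by (rule power2_less_imp_less) simp
    then show ?thesis using den[OF ReV[OF q]] by (simp add: g_def norm_divide flip: V_def)
  qed
  have hg: "h_RL (g q) = q" if q: "q \<in> ?B" for q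
  proof -
    define V e where "V = (U q)\<^sup>2" and "e = complex_of_real (2 * \<delta>)"
    have n: "1 + e * V \<noteq> 0" using den[OF ReV[OF q]] by (simp add: V_def e_def)
    have e1: "1 + e \<noteq> 0" using den[of 1] by (simp add: e_def)
    have gq: "g q = (1 - V) / (1 + e * V)" by (simp add: g_def V_def e_def)
    have "1 - g q = V * (1 + e) / (1 + e * V)" "1 + e * g q = (1 + e) / (1 + e * V)"
      unfolding gq using n by (simp_all add: field_simps)
    then have "(1 - g q) / (1 + e * g q) = V" using n e1 by simp
    then have "csqrt ((1 - g q) / (1 + e * g q)) = U q"
      using ReU[OF q] by (simp add: V_def csqrt_square)
    then have "h_RL (g q) = of_real (sqrt 2) - of_real \<delta> * U q"
      by (simp add: h_RL_def \<delta>_def e_def)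
    also have "\<dots> = q" using \<delta>0 by (simp add: U_def)
    finally show ?thesis .
  qed
  have g1: "g 1 = 0"
  proof -
    have "U 1 = 1" using \<delta>0 by (simp add: U_def \<delta>_def)
    then show ?thesis by (simp add: g_def)
  qed
  have hol_h: "h_RL holomorphic_on ball 0 1"
  proof -
    define e where "e = 2 * \<delta>"
    have e: "0 < e" "e < 1" using \<delta> by (simp_all add: e_def)
    have n: "1 + of_real e * z \<noteq> 0" if "cmod z < 1" for z
    proof -
      have "e * cmod z < 1 * 1" using e that by (intro mult_strict_mono') auto
      then have "cmod (of_real e * z) < 1" using e by (simp add: norm_mult)
      then show ?thesis by (metis add_eq_0_iff norm_minus_cancel norm_one order_less_irrefl)
    qed
    have pos: "Re ((1 - z) / (1 + of_real e * z)) > 0" if "cmod z < 1" for z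
    proof -
      have "Re ((1 - z) * cnj (1 + of_real e * z)) = (1 - e) * (1 - Re z) + e * (1 - (cmod z)\<^sup>2)"
        unfolding cmod_power2 by (simp add: power2_eq_square algebra_simps)
      also have "\<dots> > 0"
        using e that abs_Re_le_cmod[of z] abs_square_less_1[of "cmod z"]
        by (intro add_pos_pos mult_pos_pos) auto
      finally show ?thesis using n[OF that] by (simp add: Re_complex_div_gt_0)
    qed
    have eq: "h_RL = (\<lambda>z. of_real (sqrt 2) - of_real \<delta> * csqrt ((1 - z) / (1 + of_real e * z)))"
      by (simp add: h_RL_def[abs_def] \<delta>_def e_def)
    show ?thesis
      unfolding eq by (intro holomorphic_intros Re_pos_notin_nonpos_Reals n pos; simp)
  qed
  have "admissible_radius K3 S_RL r"
    unfolding S_RL_def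
  proof (rule admissible_S_star[OF r(2) _ hol_h hol less1 hg g1])
    show "log_quot f z \<in> ?B" if "f \<in> K3" "cmod z < r" for f z
      using log_quot_K3_disc[OF that r(2)] by (simp add: dist_norm norm_minus_commute)
  qed
  then show ?thesis by (simp add: r_def)
qed

section \<open>Decimal values and the normalised equations\<close>

text \<open>By monotonicity, opposite signs at the two ends of the rounding interval trap the
  root.\<close>

lemma radius_poly_root_approx:
  assumes c: "c \<le> 1" and \<rho>: "0 < \<rho>" "\<rho> < 1" "radius_poly c \<rho> = 0"
    and d: "0 \<le> d - 1 / (2 * 10 ^ n)" "d + 1 / (2 * 10 ^ n) \<le> 1"
    and lo: "radius_poly c (d - 1 / (2 * 10 ^ n)) > 0" and hi: "radius_poly c (d + 1 / (2 * 10 ^ n)) < 0"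
  shows "approx n \<rho> d"
proof -
  have p: "0 < 1 / (2 * 10 ^ n :: real)" by simp
  have "d - 1 / (2 * 10 ^ n) < \<rho>"
    by (rule radius_poly_root_greater[OF c _ _ \<rho>(3)]) (use \<rho> d p lo in linarith)+
  moreover have "\<rho> < d + 1 / (2 * 10 ^ n)"
    by (rule radius_poly_root_less[OF c _ _ \<rho>(3)]) (use \<rho> d p hi in linarith)+
  ultimately show ?thesis by (simp add: approx_def abs_le_iff)
qed

lemma sharp_root:
  assumes c: "c < 1"
    and g: "\<And>r. g r = k * radius_poly c r" "k \<noteq> 0"
    and H: "\<And>\<rho>. 0 < \<rho> \<Longrightarrow> \<rho> < 1 \<Longrightarrow> radius_poly c \<rho> = 0 \<Longrightarrow> is_sharp_radius K3 H \<rho> \<and> P \<rho>"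
  shows "\<exists>\<rho>. smallest_pos_root g \<rho> \<and> is_sharp_radius K3 H \<rho> \<and> P \<rho>"
proof -
  obtain \<rho> where \<rho>: "0 < \<rho>" "\<rho> < 1" "radius_poly c \<rho> = 0" using radius_poly_root[OF c] .
  have "smallest_pos_root g \<rho>"
    by (rule smallest_pos_root_radius_poly[OF _ \<rho>(1) _ \<rho>(3) g]) (use c \<rho> in simp_all)
  then show ?thesis using H[OF \<rho>] by blast
qed

lemma sharp_starlike_root:
  assumes "0 \<le> \<alpha>" "\<alpha> < 1"
  shows "\<exists>\<rho>. smallest_pos_root (\<lambda>r. (1 + \<alpha>) * r^4 - 2 * r * (r^2 + r + 1) + (1 - \<alpha>)) \<rho> \<and>
    is_sharp_radius K3 (starlike_of_order \<alpha>) \<rho>"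
  using sharp_root[of \<alpha> _ 1 _ "\<lambda>_. True"] sharp_starlike[of _ \<alpha>] assms by (simp add: radius_poly_def)

lemma approx_S_L: "approx 6 ((sqrt 2 - 1) / (sqrt 2 + 1)) 0.171573"
proof -
  have "(sqrt 2 - 1) / (sqrt 2 + 1) = 3 - 2 * sqrt (2::real)"
  proof -
    have "sqrt 2 + 1 \<noteq> (0::real)" using sqrt2_bounds by linarith
    then show ?thesis by (simp add: divide_simps algebra_simps)
  qed
  then show ?thesis
    using sqrt2_bounds by (simp add: approx_def abs_le_iff)
qed

lemma sharp_S_P_root:
  "\<exists>\<rho>. smallest_pos_root (\<lambda>r. 4 * r^3 + 4 * r^2 + 4 * r - 1 - 3 * r^4) \<rho> \<and>
      is_sharp_radius K3 S_P \<rho> \<and> approx 7 \<rho> 0.2021347"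
proof (rule sharp_root[where c="1 / 2" and k="- 2"])
  show "is_sharp_radius K3 S_P \<rho> \<and> approx 7 \<rho> 0.2021347"
    if "0 < \<rho>" "\<rho> < 1" "radius_poly (1 / 2) \<rho> = 0" for \<rho>
    using sharp_S_P[OF that]
    by (auto intro!: radius_poly_root_approx[OF _ that]) (simp_all add: radius_poly_def power2_eq_square power4_eq_xxxx)
qed (simp_all add: radius_poly_def power2_eq_square power3_eq_cube algebra_simps)

lemma sharp_S_e_root:
  "\<exists>\<rho>. smallest_pos_root (\<lambda>r. (2 * r^3 + 2 * r^2 + 2 * r - 1 - r^4) * exp 1 + 1 - r^4) \<rho> \<and>
      is_sharp_radius K3 S_e \<rho> \<and> approx 6 \<rho> 0.244259"
proof (rule sharp_root[where c="exp (- 1)" and k="- exp 1"])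
  show "is_sharp_radius K3 S_e \<rho> \<and> approx 6 \<rho> 0.244259"
    if "0 < \<rho>" "\<rho> < 1" "radius_poly (exp (- 1)) \<rho> = 0" for \<rho>
    using sharp_S_e[OF that] exp_minus_1_bounds
    by (auto intro!: radius_poly_root_approx[OF _ that]) (simp_all add: radius_poly_def power2_eq_square power4_eq_xxxx field_simps)
  show "(2 * r^3 + 2 * r^2 + 2 * r - 1 - r^4) * exp 1 + 1 - r^4 = - exp 1 * radius_poly (exp (- 1)) r" for r :: real
  proof -
    \<comment> \<open>With the exponentials as atoms, \<open>E * c = 1\<close> turns the claim into
      a polynomial identity.\<close>
    define E c where "E = exp (1::real)" and "c = exp (- 1::real)"
    have "E * c = 1" by (simp add: E_def c_def flip: exp_add)
    then have "(2 * r^3 + 2 * r^2 + 2 * r - 1 - r^4) * E + 1 - r^4 = - E * radius_poly c r"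
      unfolding radius_poly_def by algebra
    then show ?thesis by (simp only: E_def c_def)
  qed
qed simp_all

lemma sharp_S_c_root:
  "\<exists>\<rho>. smallest_pos_root (\<lambda>r. 3 * r^3 + 3 * r^2 + 3 * r - 1 - 2 * r^4) \<rho> \<and>
      is_sharp_radius K3 S_c \<rho> \<and> approx 6 \<rho> 0.254726"
proof (rule sharp_root[where c="1 / 3" and k="- 3 / 2"])
  show "is_sharp_radius K3 S_c \<rho> \<and> approx 6 \<rho> 0.254726"
    if "0 < \<rho>" "\<rho> < 1" "radius_poly (1 / 3) \<rho> = 0" for \<rho>
    using sharp_S_c[OF that]
    by (auto intro!: radius_poly_root_approx[OF _ that]) (simp_all add: radius_poly_def power2_eq_square power4_eq_xxxx)
qed (simp_all add: radius_poly_def power2_eq_square power3_eq_cube field_simps)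

lemma sharp_S_moon_root:
  "\<exists>\<rho>. smallest_pos_root (\<lambda>r. 2 * r^3 + 2 * r^2 + 2 * r - sqrt 2 * r^4 - (2 - sqrt 2)) \<rho> \<and>
      is_sharp_radius K3 S_moon \<rho> \<and> approx 6 \<rho> 0.229877"
proof (rule sharp_root[where c="sqrt 2 - 1" and k="- 1"])
  show "is_sharp_radius K3 S_moon \<rho> \<and> approx 6 \<rho> 0.229877"
    if "0 < \<rho>" "\<rho> < 1" "radius_poly (sqrt 2 - 1) \<rho> = 0" for \<rho>
    using sharp_S_moon[OF that] sqrt2_bounds
    by (auto intro!: radius_poly_root_approx[OF _ that]) (simp_all add: radius_poly_def power2_eq_square power4_eq_xxxx)
qed (use sqrt2_bounds in \<open>simp_all add: radius_poly_def power2_eq_square power3_eq_cube algebra_simps\<close>)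

lemma sharp_S_R_root:
  "\<exists>\<rho>. smallest_pos_root
        (\<lambda>r. r^4 + 2 * r^3 + 2 * r^2 + 2 * r - 3 + 2 * sqrt 2 * (1 - r^4)) \<rho> \<and>
      is_sharp_radius K3 S_R \<rho> \<and> approx 7 \<rho> 0.0790749"
proof (rule sharp_root[where c="2 * sqrt 2 - 2" and k="- 1"])
  show "is_sharp_radius K3 S_R \<rho> \<and> approx 7 \<rho> 0.0790749"
    if "0 < \<rho>" "\<rho> < 1" "radius_poly (2 * sqrt 2 - 2) \<rho> = 0" for \<rho>
    using sharp_S_R[OF that] sqrt2_bounds
    by (auto intro!: radius_poly_root_approx[OF _ that]) (simp_all add: radius_poly_def power2_eq_square power4_eq_xxxx field_simps)
qed (use sqrt2_bounds in \<open>simp_all add: radius_poly_def power2_eq_square power3_eq_cube algebra_simps\<close>)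

lemma approx_S_sin: "approx 6 (sin 1 / (2 + sin 1)) 0.296139"
  unfolding approx_def abs_le_iff using sin_1_bounds by (simp add: field_simps)

lemma admissible_S_RL_ex:
  "\<exists>\<rho>. admissible_radius K3 S_RL \<rho> \<and> 0.125145 \<le> \<rho> \<and> approx 6 \<rho> 0.125145"
  using admissible_S_RL by (intro exI[of _ "0.125145"]) (simp add: approx_def)

lemma sharp_radii_upper:
  "(is_sharp_radius K3 S_L ((sqrt 2 - 1) / (sqrt 2 + 1)) \<and>
      approx 6 ((sqrt 2 - 1) / (sqrt 2 + 1)) 0.171573) \<and>
     (is_sharp_radius K3 S_sin (sin 1 / (2 + sin 1)) \<and>
      approx 6 (sin 1 / (2 + sin 1)) 0.296139)"
  by (intro conjI sharp_S_L approx_S_L sharp_S_sin approx_S_sin)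

lemma sharp_radii_lower:
  "(\<exists>\<rho>. smallest_pos_root (\<lambda>r. 4 * r^3 + 4 * r^2 + 4 * r - 1 - 3 * r^4) \<rho> \<and>
          is_sharp_radius K3 S_P \<rho> \<and> approx 7 \<rho> 0.2021347) \<and>
     (\<exists>\<rho>. smallest_pos_root
            (\<lambda>r. (2 * r^3 + 2 * r^2 + 2 * r - 1 - r^4) * exp 1 + 1 - r^4) \<rho> \<and>
          is_sharp_radius K3 S_e \<rho> \<and> approx 6 \<rho> 0.244259) \<and>
     (\<exists>\<rho>. smallest_pos_root (\<lambda>r. 3 * r^3 + 3 * r^2 + 3 * r - 1 - 2 * r^4) \<rho> \<and>
          is_sharp_radius K3 S_c \<rho> \<and> approx 6 \<rho> 0.254726) \<and>
     (\<exists>\<rho>. smallest_pos_root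
            (\<lambda>r. 2 * r^3 + 2 * r^2 + 2 * r - sqrt 2 * r^4 - (2 - sqrt 2)) \<rho> \<and>
          is_sharp_radius K3 S_moon \<rho> \<and> approx 6 \<rho> 0.229877) \<and>
     (\<exists>\<rho>. smallest_pos_root
            (\<lambda>r. r^4 + 2 * r^3 + 2 * r^2 + 2 * r - 3 + 2 * sqrt 2 * (1 - r^4)) \<rho> \<and>
          is_sharp_radius K3 S_R \<rho> \<and> approx 7 \<rho> 0.0790749)"
  by (intro conjI sharp_S_P_root sharp_S_e_root sharp_S_c_root sharp_S_moon_root sharp_S_R_root)

theorem theorem2p12:
  shows
    "(\<forall>\<alpha>::real. 0 \<le> \<alpha> \<and> \<alpha> < 1 \<longrightarrow>
        (\<exists>\<rho>. smallest_pos_root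
               (\<lambda>r. (1 + \<alpha>) * r^4 - 2 * r * (r^2 + r + 1) + (1 - \<alpha>)) \<rho> \<and>
             is_sharp_radius K3 (starlike_of_order \<alpha>) \<rho>)) \<and>
     (is_sharp_radius K3 S_L ((sqrt 2 - 1) / (sqrt 2 + 1)) \<and>
      approx 6 ((sqrt 2 - 1) / (sqrt 2 + 1)) 0.171573) \<and>
     (\<exists>\<rho>. smallest_pos_root (\<lambda>r. 4 * r^3 + 4 * r^2 + 4 * r - 1 - 3 * r^4) \<rho> \<and>
          is_sharp_radius K3 S_P \<rho> \<and> approx 7 \<rho> 0.2021347) \<and>
     (\<exists>\<rho>. smallest_pos_root
            (\<lambda>r. (2 * r^3 + 2 * r^2 + 2 * r - 1 - r^4) * exp 1 + 1 - r^4) \<rho> \<and>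
          is_sharp_radius K3 S_e \<rho> \<and> approx 6 \<rho> 0.244259) \<and>
     (\<exists>\<rho>. smallest_pos_root (\<lambda>r. 3 * r^3 + 3 * r^2 + 3 * r - 1 - 2 * r^4) \<rho> \<and>
          is_sharp_radius K3 S_c \<rho> \<and> approx 6 \<rho> 0.254726) \<and>
     (\<exists>\<rho>. smallest_pos_root
            (\<lambda>r. 2 * r^3 + 2 * r^2 + 2 * r - sqrt 2 * r^4 - (2 - sqrt 2)) \<rho> \<and>
          is_sharp_radius K3 S_moon \<rho> \<and> approx 6 \<rho> 0.229877) \<and>
     (is_sharp_radius K3 S_sin (sin 1 / (2 + sin 1)) \<and>
      approx 6 (sin 1 / (2 + sin 1)) 0.296139) \<and>
     (\<exists>\<rho>. smallest_pos_root
            (\<lambda>r. r^4 + 2 * r^3 + 2 * r^2 + 2 * r - 3 + 2 * sqrt 2 * (1 - r^4)) \<rho> \<and>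
          is_sharp_radius K3 S_R \<rho> \<and> approx 7 \<rho> 0.0790749) \<and>
     (\<exists>\<rho>. admissible_radius K3 S_RL \<rho> \<and> 0.125145 \<le> \<rho> \<and> approx 6 \<rho> 0.125145)"
  using sharp_starlike_root sharp_radii_upper sharp_radii_lower admissible_S_RL_ex by blast

end
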